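(* The problem of whether a finite group $G$ is integrable is decidable. That is, there is an algorithm which, given as input a finite group $G$ (for instance by its multiplication table), always terminates and correctly decides whether or not there exists a group $H$ whose commutator subgroup $[H,H]$ is isomorphic to $G$.
   Context: An integral of a group $G$ is a group $H$ whose commutator (derived) subgroup $[H,H]$ is isomorphic to $G$; no finiteness of $H$ is assumed. A group $G$ is called integrable if it has an integral. Decidable is meant in the usual sense of computability theory, with finite groups encoded by finite data such as multiplication tables on $\{0,\dots,n-1\}$. *)

theory Defs
  imports "HOL-Algebra.Generated_Groups" "HOL-Library.Nat_Bijection"
begin

section \<open>Decidable sets of natural numbers\<close>

text \<open>Programs for the partial (mu-)recursive functions of Kleene. The recursion argument of
  primitive recursion and the search argument of minimization come first in the argument list;
  the step function of a primitive recursion is applied to the predecessor, the previous value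
  and the parameters. \<open>RZero\<close> is the constant zero of any arity.\<close>

datatype recf =
    RZero
  | RSucc
  | RProj nat
  | RComp recf "recf list"
  | RPrim recf recf
  | RMin recf

text \<open>\<open>rec_eval f xs y\<close>: the program \<open>f\<close> halts on the arguments \<open>xs\<close> with the value \<open>y\<close>.\<close>

inductive rec_eval :: "recf \<Rightarrow> nat list \<Rightarrow> nat \<Rightarrow> bool" where
  eval_zero: "rec_eval RZero xs 0"
| eval_succ: "rec_eval RSucc [x] (Suc x)"
| eval_proj: "i < length xs \<Longrightarrow> rec_eval (RProj i) xs (xs ! i)"
| eval_comp: "list_all2 (\<lambda>g y. rec_eval g xs y) gs ys \<Longrightarrow> rec_eval f ys z
    \<Longrightarrow> rec_eval (RComp f gs) xs z"
| eval_prim_0: "rec_eval f xs y \<Longrightarrow> rec_eval (RPrim f g) (0 # xs) y"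
| eval_prim_Suc: "rec_eval (RPrim f g) (n # xs) r \<Longrightarrow> rec_eval g (n # r # xs) y
    \<Longrightarrow> rec_eval (RPrim f g) (Suc n # xs) y"
| eval_min: "rec_eval f (n # xs) 0 \<Longrightarrow> (\<And>m. m < n \<Longrightarrow> \<exists>k. rec_eval f (m # xs) (Suc k))
    \<Longrightarrow> rec_eval (RMin f) xs n"
  monos list_all2_mono

lemma rec_eval_deterministic:
  "rec_eval f xs y \<Longrightarrow> rec_eval f xs z \<Longrightarrow> y = z"
proof (induction f xs y arbitrary: z rule: rec_eval.induct)
  case (eval_comp xs gs ys f w)
  from eval_comp.prems obtain ys'
    where ys': "list_all2 (\<lambda>g y. rec_eval g xs y) gs ys'" "rec_eval f ys' z"
    by cases auto
  have "ys = ys'"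
    using eval_comp.IH(1) ys'(1) by (auto simp: list_all2_conv_all_nth intro!: nth_equalityI)
  then show ?case using eval_comp.IH(2) ys'(2) by blast
next
  case (eval_min f n xs)
  from eval_min.prems have z: "rec_eval f (z # xs) 0"
      "\<And>m. m < z \<Longrightarrow> \<exists>k. rec_eval f (m # xs) (Suc k)"
    by (cases; blast)+
  show ?case
  proof (rule linorder_cases[of n z])
    assume "n < z"
    with z(2) obtain k where "rec_eval f (n # xs) (Suc k)" by blast
    with eval_min.IH(1) show ?thesis by blast
  next
    assume "z < n"
    with eval_min.IH(2) z(1) show ?thesis by blast
  qed
next
  case (eval_prim_0 f xs y g)
  from eval_prim_0.prems have "rec_eval f xs z" by cases auto
  then show ?case by (rule eval_prim_0.IH)
next
  case (eval_prim_Suc f g n xs r y)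
  from eval_prim_Suc.prems obtain r'
    where "rec_eval (RPrim f g) (n # xs) r'" "rec_eval g (n # r' # xs) z" by cases auto
  with eval_prim_Suc.IH show ?case by blast
next
  case (eval_zero xs)
  from eval_zero.prems show ?case by cases auto
next
  case (eval_succ x)
  from eval_succ.prems show ?case by cases auto
next
  case (eval_proj i xs)
  from eval_proj.prems show ?case by cases auto
qed

definition decidable_set :: "nat set \<Rightarrow> bool" where
  "decidable_set S \<longleftrightarrow> (\<exists>f. \<forall>n. rec_eval f [n] (if n \<in> S then 1 else 0))"

section \<open>Integrals of groups\<close>

definition is_integral :: "('h, 'm) monoid_scheme \<Rightarrow> ('g, 'k) monoid_scheme \<Rightarrow> bool" where
  "is_integral H G \<longleftrightarrow> group H \<and> H\<lparr>carrier := derived H (carrier H)\<rparr> \<cong> G"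

text \<open>HOL cannot quantify over types inside a formula, so the type of the elements of the
  integral is a parameter.\<close>

definition integrable_in :: "'h itself \<Rightarrow> ('g, 'k) monoid_scheme \<Rightarrow> bool" where
  "integrable_in T G \<longleftrightarrow> (\<exists>H :: 'h monoid. is_integral H G)"

section \<open>Multiplication tables\<close>

definition table_group :: "nat monoid \<Rightarrow> bool" where
  "table_group G \<longleftrightarrow> group G \<and> (\<exists>n. carrier G = {0..<n})"

definition table_code :: "nat monoid \<Rightarrow> nat" where
  "table_code G = list_encode
     (order G # [i \<otimes>\<^bsub>G\<^esub> j. i \<leftarrow> [0..<order G], j \<leftarrow> [0..<order G]])"

end

theory Submission
  imports Defs "HOL-Algebra.Multiplicative_Group"
begin

text \<open>
  The theorem follows from a bound: a group \<open>G\<close> of finite order \<open>n\<close> that has any integral at all has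
  one of order at most \<open>n * (n * n ^ n) ^ (2 * n)\<close> (\<open>bounded_integral\<close>). Up to isomorphism the
  elements of such an integral are natural numbers, which is the second half of the theorem, and
  there are only finitely many multiplication tables to search, which gives the first half.

  To see the bound, let \<open>H\<close> be a group whose derived subgroup \<open>D\<close> is isomorphic to \<open>G\<close>. There are at
  most \<open>n\<close> commutators in \<open>H\<close>, hence a set \<open>S\<close> of at most \<open>2 * n\<close> elements of \<open>H\<close> whose commutators
  already generate \<open>D\<close> (\<open>finite_derived_generators\<close>). Every \<open>s\<close> in \<open>S\<close> has a central power with
  exponent \<open>e s \<le> n * n ^ n\<close> (\<open>power_central\<close>): as there are only \<open>n ^ n\<close> self-maps of \<open>D\<close>, some
  power \<open>u\<close> of \<open>s\<close> acts trivially on \<open>D\<close> by conjugation; then \<open>u\<close> commutes with every commutator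
  \<open>[y, u]\<close>, so \<open>[y, u ^ n] = [y, u] ^ n = 1\<close>.

  One would like to divide by these central powers, but they may generate elements of \<open>D\<close>. So \<open>H\<close> is
  first replaced by the pullback \<open>K\<close> of the quotient map from \<open>H\<close> to \<open>H / D\<close> and the homomorphism
  from the free abelian group \<open>\<int>\<^sup>S\<close> to \<open>H / D\<close> that extends \<open>s \<mapsto> s D\<close>. The derived subgroup of \<open>K\<close>
  is \<open>D \<times> 0\<close>. The central powers lift to central elements of \<open>K\<close> whose second components
  are the multiples \<open>e s\<close> of the basis vectors; by independence of these the subgroup
  \<open>Z\<close> that they generate meets \<open>D \<times> 0\<close> trivially. Therefore \<open>K / Z\<close> is still an integral of \<open>G\<close>, and
  it has at most \<open>n * (\<Prod>s\<in>S. e s)\<close> elements, because an element of \<open>K\<close> is determined modulo \<open>Z\<close>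
  by reduced second components and one of at most \<open>n\<close> first components (locale
  \<open>abelianization_cover\<close>).

  For the search, a map between initial segments of the natural numbers is coded by a single number,
  whose digits in a suitable base are the values of the map. All objects in question, namely
  multiplication tables, homomorphisms and subsets, then range over numbers below explicit bounds, so
  that integrability becomes a formula with bounded quantifiers only, and such formulas are decided by
  primitive recursion.
\<close>

section \<open>Closure properties of computable functions\<close>

text \<open>The arity is part of the notion because a projection halts only on argument lists that are long
  enough. Functions take the whole argument list and access it by position, so that the variables of
  nested quantifiers become de Bruijn indices.\<close>

definition computable :: "nat \<Rightarrow> (nat list \<Rightarrow> nat) \<Rightarrow> bool" where
  "computable k f \<longleftrightarrow> (\<exists>p. \<forall>xs. length xs = k \<longrightarrow> rec_eval p xs (f xs))"

abbreviation decidable :: "nat \<Rightarrow> (nat list \<Rightarrow> bool) \<Rightarrow> bool" where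
  "decidable k P \<equiv> computable k (\<lambda>xs. of_bool (P xs))"

lemma computable_cong:
  assumes "\<And>xs. length xs = k \<Longrightarrow> f xs = g xs"
  shows "computable k f \<longleftrightarrow> computable k g"
  using assms by (simp add: computable_def)

lemma computable_comp:
  assumes f: "computable (length gs) f" and gs: "\<And>g. g \<in> set gs \<Longrightarrow> computable k g"
  shows "computable k (\<lambda>xs. f (map (\<lambda>g. g xs) gs))"
proof -
  obtain p where p: "\<And>xs. length xs = length gs \<Longrightarrow> rec_eval p xs (f xs)"
    using f by (auto simp: computable_def)
  obtain q where q: "\<And>g xs. g \<in> set gs \<Longrightarrow> length xs = k \<Longrightarrow> rec_eval (q g) xs (g xs)"
    using gs unfolding computable_def by metis
  have "rec_eval (RComp p (map q gs)) xs (f (map (\<lambda>g. g xs) gs))" if "length xs = k" for xs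
    by (rule eval_comp[OF _ p]) (auto simp: list_all2_conv_all_nth q that)
  then show ?thesis by (auto simp: computable_def)
qed

text \<open>These rules pass from a curried function that was shown to be computable at the positions of its own
  argument list to its use with arbitrary computable arguments, in any arity.\<close>

lemma computable_subst1:
  assumes "computable 1 (\<lambda>ys. F (ys ! 0))" "computable k f"
  shows "computable k (\<lambda>xs. F (f xs))"
  using computable_comp[of "[f]" "\<lambda>ys. F (ys ! 0)" k] assms by simp

lemma computable_subst2:
  assumes "computable 2 (\<lambda>ys. F (ys ! 0) (ys ! 1))" "computable k f" "computable k g"
  shows "computable k (\<lambda>xs. F (f xs) (g xs))"
  using computable_comp[of "[f, g]" "\<lambda>ys. F (ys ! 0) (ys ! 1)" k] assms
  by (simp add: numeral_2_eq_2) blast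

lemma computable_subst3:
  assumes "computable 3 (\<lambda>ys. F (ys ! 0) (ys ! 1) (ys ! 2))"
    "computable k f" "computable k g" "computable k h"
  shows "computable k (\<lambda>xs. F (f xs) (g xs) (h xs))"
  using computable_comp[of "[f, g, h]" "\<lambda>ys. F (ys ! 0) (ys ! 1) (ys ! 2)" k] assms
  by (simp add: numeral_2_eq_2 numeral_3_eq_3) blast

lemma computable_subst6:
  assumes "computable 6 (\<lambda>ys. F (ys ! 0) (ys ! 1) (ys ! 2) (ys ! 3) (ys ! 4) (ys ! 5))"
    "computable k f0" "computable k f1" "computable k f2"
    "computable k f3" "computable k f4" "computable k f5"
  shows "computable k (\<lambda>xs. F (f0 xs) (f1 xs) (f2 xs) (f3 xs) (f4 xs) (f5 xs))"
  using computable_comp[of "[f0, f1, f2, f3, f4, f5]"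
    "\<lambda>ys. F (ys ! 0) (ys ! 1) (ys ! 2) (ys ! 3) (ys ! 4) (ys ! 5)" k] assms
  by (simp add: eval_nat_numeral) blast

named_theorems computable_rules

lemma computable_nth [computable_rules]: "i < k \<Longrightarrow> computable k (\<lambda>xs. xs ! i)"
  unfolding computable_def by (intro exI[of _ "RProj i"]) (auto intro: eval_proj)

text \<open>Below nested quantifiers, a variable bound further outside appears in the argument list with the inner
  ones dropped.\<close>

lemma computable_nth_drop [computable_rules]:
  "a + i < k \<Longrightarrow> computable k (\<lambda>xs. drop a xs ! i)"
  "a + b + i < k \<Longrightarrow> computable k (\<lambda>xs. drop a (drop b xs) ! i)"
  "a + b + c + i < k \<Longrightarrow> computable k (\<lambda>xs. drop a (drop b (drop c xs)) ! i)"
  "a + b + c + d + i < k \<Longrightarrow> computable k (\<lambda>xs. drop a (drop b (drop c (drop d xs))) ! i)"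
proof -
  have *: "computable k (\<lambda>xs. drop a xs ! i)" if "a + i < k" for a
    using computable_nth[OF that] that computable_cong[of k "\<lambda>xs. drop a xs ! i" "\<lambda>xs. xs ! (a + i)"]
    by simp
  show "a + i < k \<Longrightarrow> computable k (\<lambda>xs. drop a xs ! i)"
  "a + b + i < k \<Longrightarrow> computable k (\<lambda>xs. drop a (drop b xs) ! i)"
  "a + b + c + i < k \<Longrightarrow> computable k (\<lambda>xs. drop a (drop b (drop c xs)) ! i)"
  "a + b + c + d + i < k \<Longrightarrow> computable k (\<lambda>xs. drop a (drop b (drop c (drop d xs))) ! i)"
    by (simp_all add: * ac_simps)
qed

lemma computable_Suc [computable_rules]:
  assumes "computable k f" shows "computable k (\<lambda>xs. Suc (f xs))"
proof (rule computable_subst1[OF _ assms])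
  have "rec_eval RSucc xs (Suc (xs ! 0))" if "length xs = 1" for xs
    using that eval_succ by (cases xs) auto
  then show "computable 1 (\<lambda>ys. Suc (ys ! 0))" by (auto simp: computable_def)
qed

lemma computable_0 [computable_rules]: "computable k (\<lambda>xs. 0)"
  unfolding computable_def by (intro exI[of _ RZero]) (auto intro: eval_zero)

lemma computable_const: "computable k (\<lambda>xs. c)"
  by (induction c) (auto intro: computable_rules)

lemmas computable_numeral [computable_rules] =
  computable_const[where c = 1] computable_const[where c = "numeral n" for n]

text \<open>Stated for \<^const>\<open>rec_nat\<close>, so that a function is shown to be computable by writing it as a
  recursion over the naturals, with no program in sight. The value \<open>h\<close> of the step depends on the
  parameters \<open>xs\<close>, which are what remains of the argument list of the step program after the
  predecessor and the previous value.\<close>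

lemma computable_rec_nat:
  assumes g: "computable k g" and b: "computable k b"
    and h: "computable (Suc (Suc k)) (\<lambda>ys. h (ys ! 0) (ys ! 1) (drop 2 ys))"
  shows "computable k (\<lambda>xs. rec_nat (g xs) (\<lambda>n r. h n r xs) (b xs))"
proof -
  let ?f = "\<lambda>ys. rec_nat (g (drop 1 ys)) (\<lambda>n r. h n r (drop 1 ys)) (ys ! 0)"
  obtain p where p: "\<And>xs. length xs = k \<Longrightarrow> rec_eval p xs (g xs)"
    using g by (auto simp: computable_def)
  obtain q where q: "\<And>ys. length ys = Suc (Suc k) \<Longrightarrow>
      rec_eval q ys (h (ys ! 0) (ys ! 1) (drop 2 ys))"
    using h by (auto simp: computable_def)
  have "rec_eval (RPrim p q) (n # xs) (rec_nat (g xs) (\<lambda>n r. h n r xs) n)"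
    if "length xs = k" for n xs
  proof (induction n)
    case 0
    show ?case by (simp add: eval_prim_0 p that)
  next
    case (Suc n)
    from eval_prim_Suc[OF Suc.IH] q[of "n # rec_nat (g xs) (\<lambda>n r. h n r xs) n # xs"] that
    show ?case by simp
  qed
  then have "rec_eval (RPrim p q) ys (?f ys)" if "length ys = Suc k" for ys
    using that by (cases ys) auto
  then have f: "computable (Suc k) ?f" by (auto simp: computable_def)
  let ?gs = "b # map (\<lambda>i xs. xs ! i) [0..<k]"
  have "computable k (\<lambda>xs. ?f (map (\<lambda>g. g xs) ?gs))"
    by (rule computable_comp) (use b f in \<open>auto intro: computable_nth\<close>)
  moreover have "map (\<lambda>g. g xs) ?gs = b xs # xs" if "length xs = k" for xs :: "nat list"
    using that by (auto intro: nth_equalityI)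
  ultimately show ?thesis
    by (subst computable_cong[of k _ "\<lambda>xs. ?f (map (\<lambda>g. g xs) ?gs)"]) auto
qed

lemma computable_add [computable_rules]:
  assumes "computable k f" "computable k g" shows "computable k (\<lambda>xs. f xs + g xs)"
proof -
  have "rec_nat a (\<lambda>n r. Suc r) b = a + b" for a b by (induction b) auto
  moreover have "computable k (\<lambda>xs. rec_nat (f xs) (\<lambda>n r. Suc r) (g xs))"
    by (intro computable_rec_nat assms computable_rules) auto
  ultimately show ?thesis by simp
qed

lemma computable_mult [computable_rules]:
  assumes "computable k f" "computable k g" shows "computable k (\<lambda>xs. f xs * g xs)"
proof (rule computable_subst2[OF _ assms])
  have "rec_nat 0 (\<lambda>n r. r + a) b = a * b" for a b :: nat by (induction b) auto
  moreover have "computable 2 (\<lambda>xs. rec_nat 0 (\<lambda>n r. r + xs ! 0) (xs ! 1))"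
    by (intro computable_rec_nat computable_rules) auto
  ultimately show "computable 2 (\<lambda>xs. xs ! 0 * xs ! 1)" by simp
qed

lemma computable_power [computable_rules]:
  assumes "computable k f" "computable k g" shows "computable k (\<lambda>xs. f xs ^ g xs)"
proof (rule computable_subst2[OF _ assms])
  have "rec_nat 1 (\<lambda>n r. a * r) b = a ^ b" for a b :: nat by (induction b) auto
  moreover have "computable 2 (\<lambda>xs. rec_nat 1 (\<lambda>n r. xs ! 0 * r) (xs ! 1))"
    by (intro computable_rec_nat computable_rules) auto
  ultimately show "computable 2 (\<lambda>xs. xs ! 0 ^ xs ! 1)" by simp
qed

lemma computable_diff [computable_rules]:
  assumes "computable k f" "computable k g" shows "computable k (\<lambda>xs. f xs - g xs)"
proof (rule computable_subst2[OF _ assms])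
  have "rec_nat 0 (\<lambda>n r. n) b = b - 1" for b :: nat by (cases b) auto
  moreover have "computable 1 (\<lambda>xs. rec_nat 0 (\<lambda>n r. n) (xs ! 0))"
    by (intro computable_rec_nat computable_rules) auto
  ultimately have pred: "computable 1 (\<lambda>xs. xs ! 0 - 1)" by simp
  have "rec_nat a (\<lambda>n r. r - 1) b = a - b" for a b :: nat by (induction b) auto
  moreover have "computable 2 (\<lambda>xs. rec_nat (xs ! 0) (\<lambda>n r. r - 1) (xs ! 1))"
    by (intro computable_rec_nat computable_rules computable_subst1[OF pred]) auto
  ultimately show "computable 2 (\<lambda>xs. xs ! 0 - xs ! 1)" by simp
qed

lemma decidable_not [computable_rules]:
  assumes "decidable k P" shows "decidable k (\<lambda>xs. \<not> P xs)"
proof -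
  have "computable k (\<lambda>xs. 1 - of_bool (P xs))" by (intro computable_rules assms)
  moreover have "of_bool (\<not> b) = (1 - of_bool b :: nat)" for b by auto
  ultimately show ?thesis by presburger
qed

lemma decidable_conj [computable_rules]:
  assumes "decidable k P" "decidable k Q" shows "decidable k (\<lambda>xs. P xs \<and> Q xs)"
  unfolding of_bool_conj by (intro computable_rules assms)

lemma decidable_imp [computable_rules]:
  assumes "decidable k P" "decidable k Q" shows "decidable k (\<lambda>xs. P xs \<longrightarrow> Q xs)"
proof -
  have "decidable k (\<lambda>xs. \<not> (P xs \<and> \<not> Q xs))" by (intro computable_rules assms)
  then show ?thesis by simp
qed

lemma decidable_le [computable_rules]:
  assumes "computable k f" "computable k g" shows "decidable k (\<lambda>xs. f xs \<le> g xs)"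
proof -
  have "computable k (\<lambda>xs. 1 - (f xs - g xs))" by (intro computable_rules assms)
  moreover have "of_bool (a \<le> b) = 1 - (a - b)" for a b :: nat by auto
  ultimately show ?thesis by presburger
qed

lemma decidable_less [computable_rules]:
  assumes "computable k f" "computable k g" shows "decidable k (\<lambda>xs. f xs < g xs)"
  unfolding less_eq_Suc_le by (intro computable_rules assms)

lemma decidable_eq [computable_rules]:
  assumes "computable k f" "computable k g" shows "decidable k (\<lambda>xs. f xs = g xs)"
  unfolding eq_iff by (intro computable_rules assms)

lemma computable_if [computable_rules]:
  assumes "decidable k P" "computable k f" "computable k g"
  shows "computable k (\<lambda>xs. if P xs then f xs else g xs)"
proof -
  have "computable k (\<lambda>xs. of_bool (P xs) * f xs + of_bool (\<not> P xs) * g xs)"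
    by (intro computable_rules assms)
  moreover have "(if b then m else n) = of_bool b * m + of_bool (\<not> b) * n" for b and m n :: nat
    by auto
  ultimately show ?thesis by presburger
qed

text \<open>A bounded search, run as a recursion that remembers whether a witness was met so far.\<close>

lemma decidable_bex [computable_rules]:
  assumes b: "computable k b" and P: "decidable (Suc k) (\<lambda>ys. P (ys ! 0) (drop 1 ys))"
  shows "decidable k (\<lambda>xs. \<exists>m<b xs. P m xs)"
proof -
  have "computable (Suc (Suc k)) (\<lambda>ys. of_bool (P (ys ! 0) (drop 2 ys)))"
  proof -
    let ?gs = "map (\<lambda>i ys. ys ! i) (0 # [2..<Suc (Suc k)])"
    let ?f = "\<lambda>ys. of_bool (P (ys ! 0) (drop 1 ys)) :: nat"
    have "computable (Suc (Suc k)) (\<lambda>ys. ?f (map (\<lambda>g. g ys) ?gs))"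
      by (rule computable_comp) (use P in \<open>auto intro: computable_nth simp del: upt_Suc\<close>)
    moreover have "map (\<lambda>g. g ys) ?gs = ys ! 0 # drop 2 ys"
      if "length ys = Suc (Suc k)" for ys :: "nat list"
      using that by (auto intro!: nth_equalityI simp: nth_Cons' simp del: upt_Suc)
    ultimately show ?thesis
      by (subst computable_cong[of _ _ "\<lambda>ys. ?f (map (\<lambda>g. g ys) ?gs)"]) auto
  qed
  then have "computable k (\<lambda>xs. rec_nat 0 (\<lambda>n r. if P n xs then 1 else r) (b xs))"
    by (intro computable_rec_nat computable_rules b) auto
  moreover have "rec_nat 0 (\<lambda>n r. if Q n then 1 else r) c = (of_bool (\<exists>m<c. Q m) :: nat)"
    for Q and c :: nat
    by (induction c) (auto simp: less_Suc_eq)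
  ultimately show ?thesis by simp
qed

lemma decidable_ball [computable_rules]:
  assumes b: "computable k b" and P: "decidable (Suc k) (\<lambda>ys. P (ys ! 0) (drop 1 ys))"
  shows "decidable k (\<lambda>xs. \<forall>m<b xs. P m xs)"
proof -
  have "decidable k (\<lambda>xs. \<not> (\<exists>m<b xs. \<not> P m xs))" by (intro computable_rules assms)
  then show ?thesis by simp
qed

lemma computable_mod [computable_rules]:
  assumes "computable k f" "computable k g" shows "computable k (\<lambda>xs. f xs mod g xs)"
proof (rule computable_subst2[OF _ assms])
  have "rec_nat 0 (\<lambda>n r. if Suc r = b then 0 else Suc r) a = a mod b" for a b :: nat
    by (induction a) (auto simp: mod_Suc)
  moreover have "computable 2 (\<lambda>xs. rec_nat 0 (\<lambda>n r. if Suc r = xs ! 1 then 0 else Suc r) (xs ! 0))"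
    by (intro computable_rec_nat computable_rules) auto
  ultimately show "computable 2 (\<lambda>xs. xs ! 0 mod xs ! 1)" by simp
qed

lemma computable_div [computable_rules]:
  assumes "computable k f" "computable k g" shows "computable k (\<lambda>xs. f xs div g xs)"
proof (rule computable_subst2[OF _ assms])
  have "rec_nat 0 (\<lambda>n r. if Suc n mod b = 0 then Suc r else r) a = a div b" for a b :: nat
    by (induction a) (auto simp: div_Suc)
  moreover have "computable 2 (\<lambda>xs. rec_nat 0 (\<lambda>n r. if Suc n mod xs ! 1 = 0 then Suc r else r) (xs ! 0))"
    by (intro computable_rec_nat computable_rules) auto
  ultimately show "computable 2 (\<lambda>xs. xs ! 0 div xs ! 1)" by simp
qed

lemma decidable_setI:
  assumes "decidable 1 (\<lambda>xs. P (xs ! 0))"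
  shows "decidable_set {z. P z}"
proof -
  obtain p where p: "\<And>xs. length xs = 1 \<Longrightarrow> rec_eval p xs (of_bool (P (xs ! 0)))"
    using assms by (auto simp: computable_def)
  have "rec_eval p [n] (if n \<in> {z. P z} then 1 else 0)" for n
    using p[of "[n]"] by (auto split: if_splits)
  then show ?thesis unfolding decidable_set_def by blast
qed

section \<open>Finite maps as digit sequences\<close>

definition digit :: "nat \<Rightarrow> nat \<Rightarrow> nat \<Rightarrow> nat" where
  "digit b t i = t div b ^ i mod b"

lemma computable_digit [computable_rules]:
  assumes "computable k b" "computable k t" "computable k i"
  shows "computable k (\<lambda>xs. digit (b xs) (t xs) (i xs))"
  unfolding digit_def by (intro computable_rules assms)

lemma digit_less: "0 < b \<Longrightarrow> digit b t i < b"
  by (simp add: digit_def)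

text \<open>By this bound, a quantifier over maps from \<open>{0..<M}\<close> to \<open>{0..<b}\<close> is a bounded quantifier over
  numbers.\<close>

lemma ex_digits:
  assumes "\<And>i. i < M \<Longrightarrow> f i < b"
  shows "\<exists>t<b ^ M. \<forall>i<M. digit b t i = f i"
  using assms
proof (induction M)
  case 0
  show ?case by simp
next
  case (Suc M)
  then obtain t where t: "t < b ^ M" "\<forall>i<M. digit b t i = f i" by auto
  have b: "0 < b" using Suc.prems[of M] by simp
  let ?t = "t + f M * b ^ M"
  have "?t < b ^ M + f M * b ^ M" using t(1) by simp
  also have "\<dots> = Suc (f M) * b ^ M" by simp
  also have "\<dots> \<le> b * b ^ M" using Suc.prems[of M] by (intro mult_right_mono) auto
  finally have less: "?t < b ^ Suc M" by simp
  have "digit b ?t i = f i" if "i < Suc M" for i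
  proof (cases "i = M")
    case True
    then show ?thesis using t(1) b Suc.prems[of M] by (simp add: digit_def)
  next
    case False
    then have i: "i < M" using that by simp
    have "b ^ M = b ^ i * b * b ^ (M - Suc i)"
      using i by (metis Suc_leI le_add_diff_inverse power_add power_Suc2)
    then have "?t = t + b ^ i * (b * (f M * b ^ (M - Suc i)))" by (simp add: ac_simps)
    then have "?t div b ^ i = b * (f M * b ^ (M - Suc i)) + t div b ^ i"
      using b by (metis div_mult_self2 power_not_zero less_not_refl2)
    then show ?thesis using t(2) i by (simp add: digit_def)
  qed
  with less show ?case by blast
qed

section \<open>Groups with finite derived subgroup\<close>

lemma (in group_hom) derived_iso:
  assumes inj: "inj_on h (derived G (carrier G))"
    and img: "h ` derived G (carrier G) = derived H (carrier H)"
  shows "G\<lparr>carrier := derived G (carrier G)\<rparr> \<cong> H\<lparr>carrier := derived H (carrier H)\<rparr>"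
proof (rule is_isoI, rule isoI)
  show "h \<in> hom (G\<lparr>carrier := derived G (carrier G)\<rparr>) (H\<lparr>carrier := derived H (carrier H)\<rparr>)"
    using img G.derived_in_carrier[of "carrier G"] by (auto simp: hom_def subset_iff)
qed (use inj img in \<open>auto simp: bij_betw_def\<close>)

lemma is_integral_preimage:
  assumes hom: "group_hom M H h" and "is_integral H G"
    and inj: "inj_on h (derived M (carrier M))"
    and img: "h ` derived M (carrier M) = derived H (carrier H)"
  shows "is_integral M G"
  using group_hom.derived_iso[OF hom inj img] assms(2) group_hom.axioms(1)[OF hom]
  unfolding is_integral_def by (blast intro: iso_trans)

lemma is_integral_image:
  assumes hom: "group_hom M H h" and M: "is_integral M G" and surj: "h ` carrier M = carrier H"
    and inj: "inj_on h (derived M (carrier M))"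
  shows "is_integral H G"
proof -
  interpret group_hom M H h by (rule hom)
  have "h ` derived M (carrier M) = derived H (carrier H)"
    using derived_img[of "carrier M"] surj by simp
  then have "M\<lparr>carrier := derived M (carrier M)\<rparr> \<cong> H\<lparr>carrier := derived H (carrier H)\<rparr>"
    by (rule derived_iso[OF inj])
  moreover have "group (M\<lparr>carrier := derived M (carrier M)\<rparr>)"
    by (simp add: G.derived_is_subgroup G.subgroup_imp_group)
  ultimately have "H\<lparr>carrier := derived H (carrier H)\<rparr> \<cong> M\<lparr>carrier := derived M (carrier M)\<rparr>"
    by (blast intro: group.iso_sym)
  then show ?thesis
    using M H.group_axioms unfolding is_integral_def by (blast intro: iso_trans)
qed

text \<open>The commutators lie in the finite derived subgroup, so there are no more of them than it has elements;
  the set \<open>S\<close> collects the two entries of one representation of each.\<close>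

lemma (in group) finite_derived_generators:
  assumes fin: "finite (derived G (carrier G))"
  obtains S where "finite S" "S \<subseteq> carrier G" "card S \<le> 2 * card (derived G (carrier G))"
    "\<forall>T. S \<subseteq> T \<longrightarrow> T \<subseteq> carrier G \<longrightarrow> derived G T = derived G (carrier G)"
proof -
  define C where "C = derived_set G (carrier G)"
  have CD: "C \<subseteq> derived G (carrier G)"
    unfolding C_def derived_def by (auto intro: generate.incl)
  then have finC: "finite C" using fin finite_subset by blast
  have "\<forall>c\<in>C. \<exists>x\<in>carrier G. \<exists>y\<in>carrier G. c = x \<otimes> y \<otimes> inv x \<otimes> inv y"
    unfolding C_def by blast
  then obtain a b where ab: "\<And>c. c \<in> C \<Longrightarrow> a c \<in> carrier G \<and> b c \<in> carrier G \<and>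
      c = a c \<otimes> b c \<otimes> inv (a c) \<otimes> inv (b c)"
    by metis
  have "card (a ` C \<union> b ` C) \<le> card (a ` C) + card (b ` C)" by (rule card_Un_le)
  also have "\<dots> \<le> card C + card C" by (intro add_mono card_image_le finC)
  also have "\<dots> \<le> 2 * card (derived G (carrier G))" using card_mono[OF fin CD] by simp
  finally have card: "card (a ` C \<union> b ` C) \<le> 2 * card (derived G (carrier G))" .
  have "derived G T = derived G (carrier G)" if T: "a ` C \<union> b ` C \<subseteq> T" "T \<subseteq> carrier G" for T
  proof -
    have "C \<subseteq> derived_set G T"
    proof
      fix c assume c: "c \<in> C"
      then have "a c \<in> T" "b c \<in> T" using T by auto
      then show "c \<in> derived_set G T" using ab[OF c] by blast
    qed
    then have "derived G (carrier G) \<subseteq> derived G T"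
      unfolding derived_def C_def by (rule mono_generate)
    with mono_derived[OF T(2)] show ?thesis by blast
  qed
  then have "\<forall>T. a ` C \<union> b ` C \<subseteq> T \<longrightarrow> T \<subseteq> carrier G \<longrightarrow> derived G T = derived G (carrier G)"
    by blast
  moreover have "finite (a ` C \<union> b ` C)" using finC by simp
  moreover have "a ` C \<union> b ` C \<subseteq> carrier G" using ab by blast
  ultimately show ?thesis using card that by presburger
qed

lemma (in group) conj_pow:
  assumes "x \<in> carrier G" "y \<in> carrier G"
  shows "(y \<otimes> x \<otimes> inv y) [^] (n::nat) = y \<otimes> x [^] n \<otimes> inv y"
proof (induction n)
  case (Suc n)
  have "(y \<otimes> x \<otimes> inv y) [^] Suc n = (y \<otimes> x [^] n \<otimes> inv y) \<otimes> (y \<otimes> x \<otimes> inv y)"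
    using Suc by simp
  also have "\<dots> = y \<otimes> x [^] n \<otimes> (inv y \<otimes> y) \<otimes> x \<otimes> inv y"
    using assms by (simp add: m_assoc del: l_inv Units_l_inv)
  finally show ?case using assms by (simp add: m_assoc)
qed (use assms in simp)

text \<open>Conjugation by powers of \<open>x\<close> gives maps from the derived subgroup to itself. Among the powers up to
  \<open>n ^ n\<close> two give the same map, so the quotient \<open>u\<close> of these powers centralizes the derived subgroup.
  Then conjugating \<open>u\<close> by \<open>y\<close> multiplies it by a commutator \<open>c\<close> that commutes with \<open>u\<close>, and
  \<open>(c \<otimes> u) [^] n = u [^] n\<close> because \<open>c [^] n\<close> is trivial.\<close>

lemma (in group) power_central:
  assumes fin: "finite (derived G (carrier G))" and x: "x \<in> carrier G"
    and n: "n = card (derived G (carrier G))"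
  obtains e :: nat where "0 < e" "e \<le> n * n ^ n"
    "\<forall>y\<in>carrier G. x [^] e \<otimes> y = y \<otimes> x [^] e"
proof -
  let ?D = "derived G (carrier G)"
  interpret D: normal ?D G by (rule derived_self_is_normal)
  define \<phi> where "\<phi> = (\<lambda>i::nat. \<lambda>d\<in>?D. x [^] i \<otimes> d \<otimes> inv (x [^] i))"
  have "\<phi> ` {..n ^ n} \<subseteq> (?D \<rightarrow>\<^sub>E ?D)"
    using D.inv_op_closed2[OF nat_pow_closed[OF x]] by (auto simp: \<phi>_def)
  then have "card (\<phi> ` {..n ^ n}) \<le> card (?D \<rightarrow>\<^sub>E ?D)"
    by (intro card_mono finite_PiE fin)
  also have "\<dots> = n ^ n" by (simp add: card_PiE fin n)
  finally have "\<not> inj_on \<phi> {..n ^ n}"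
    by (auto dest: card_image)
  then obtain i j where ij: "i < j" "j \<le> n ^ n" "\<phi> i = \<phi> j"
    unfolding inj_on_def by (metis atMost_iff linorder_neqE_nat)
  define m where "m = j - i"
  define u where "u = x [^] m"
  have u: "u \<in> carrier G" using x by (simp add: u_def)
  have comm: "u \<otimes> d = d \<otimes> u" if d: "d \<in> ?D" for d
  proof -
    have dc: "d \<in> carrier G" using d D.subset by blast
    have xj: "x [^] j = x [^] i \<otimes> u"
      using ij(1) x by (simp add: u_def m_def nat_pow_mult)
    have "x [^] i \<otimes> d \<otimes> inv (x [^] i) = x [^] j \<otimes> d \<otimes> inv (x [^] j)"
      using fun_cong[OF ij(3), of d] d by (simp add: \<phi>_def)
    also have "\<dots> = x [^] i \<otimes> (u \<otimes> d \<otimes> inv u) \<otimes> inv (x [^] i)"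
      unfolding xj using x u dc by (simp add: m_assoc inv_mult_group)
    finally have "d = u \<otimes> d \<otimes> inv u" using x u dc by simp
    then have "d \<otimes> u = u \<otimes> d \<otimes> inv u \<otimes> u" by simp
    then show ?thesis using u dc by (simp add: m_assoc)
  qed
  have central: "u [^] n \<otimes> y = y \<otimes> u [^] n" if y: "y \<in> carrier G" for y
  proof -
    define c where "c = y \<otimes> u \<otimes> inv y \<otimes> inv u"
    have c: "c \<in> ?D" unfolding c_def derived_def using y u by (auto intro!: generate.incl)
    have cc: "c \<in> carrier G" using c D.subset by blast
    have "c [^] n = c [^]\<^bsub>G\<lparr>carrier := ?D\<rparr>\<^esub> order (G\<lparr>carrier := ?D\<rparr>)"
      by (simp add: n order_def nat_pow_consistent[symmetric])
    also have "\<dots> = \<one>"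
      using group.pow_order_eq_1[OF subgroup_imp_group[OF D.subgroup_axioms], of c] c by simp
    finally have cn: "c [^] n = \<one>" .
    have "y \<otimes> u \<otimes> inv y = c \<otimes> u" using y u by (simp add: c_def m_assoc)
    then have "y \<otimes> u [^] n \<otimes> inv y = (c \<otimes> u) [^] n" using conj_pow[OF u y, of n] by simp
    also have "\<dots> = u [^] n" using pow_mult_distrib[OF comm[OF c, symmetric] cc u] cn u by simp
    finally have "u [^] n \<otimes> y = y \<otimes> u [^] n \<otimes> inv y \<otimes> y" by simp
    then show ?thesis using y u by (simp add: m_assoc)
  qed
  show ?thesis
  proof (rule that[of "m * n"])
    have "?D \<noteq> {}" using D.one_closed by blast
    then have "0 < n" unfolding n using fin by (simp add: card_gt_0_iff)
    then show "0 < m * n" using ij by (simp add: m_def)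
    have "m \<le> n ^ n" unfolding m_def using ij(2) by (rule le_trans[OF diff_le_self])
    then show "m * n \<le> n * n ^ n" by (subst mult.commute) (rule mult_le_mono2)
    show "\<forall>y\<in>carrier G. x [^] (m * n) \<otimes> y = y \<otimes> x [^] (m * n)"
      using central x by (simp add: u_def nat_pow_pow)
  qed
qed

lemma hom_finprod_comm_group:
  assumes C: "comm_group C" and A: "comm_group A" and h: "h \<in> hom C A" and f: "f \<in> S \<rightarrow> carrier C"
  shows "h (finprod C f S) = finprod A (\<lambda>s. h (f s)) S"
proof -
  interpret C: comm_group C by (rule C)
  interpret A: comm_group A by (rule A)
  interpret group_hom C A h by unfold_locales (rule h)
  show ?thesis using f
  proof (induction S rule: infinite_finite_induct)
    case (insert s S)
    then have "f \<in> S \<rightarrow> carrier C" "f s \<in> carrier C" by auto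
    with insert show ?case by (simp add: Pi_iff)
  qed auto
qed

lemma (in group) center_subgroup:
  "subgroup {x \<in> carrier G. \<forall>y\<in>carrier G. x \<otimes> y = y \<otimes> x} G" (is "subgroup ?Z G")
proof (rule subgroupI)
  fix a b assume a: "a \<in> ?Z" and b: "b \<in> ?Z"
  have "inv a \<otimes> y = y \<otimes> inv a" if y: "y \<in> carrier G" for y
  proof -
    have ac: "a \<in> carrier G" and ay: "a \<otimes> y = y \<otimes> a" using a y by auto
    have "y \<otimes> inv a = inv a \<otimes> (a \<otimes> y) \<otimes> inv a" using ac y by (simp add: m_assoc[symmetric])
    also have "\<dots> = inv a \<otimes> y" unfolding ay using ac y by (simp add: m_assoc)
    finally show ?thesis ..
  qed
  moreover have "inv a \<in> carrier G" using a by blast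
  ultimately show "inv a \<in> ?Z" by blast
  have "a \<otimes> b \<otimes> y = y \<otimes> (a \<otimes> b)" if y: "y \<in> carrier G" for y
  proof -
    have c: "a \<in> carrier G" "b \<in> carrier G" and ay: "a \<otimes> y = y \<otimes> a" and yb: "b \<otimes> y = y \<otimes> b"
      using a b y by auto
    have "a \<otimes> b \<otimes> y = a \<otimes> (b \<otimes> y)" using c y by (simp add: m_assoc)
    also have "\<dots> = a \<otimes> y \<otimes> b" unfolding yb using c y by (simp add: m_assoc)
    also have "\<dots> = y \<otimes> (a \<otimes> b)" unfolding ay using c y by (simp add: m_assoc)
    finally show ?thesis .
  qed
  moreover have "a \<otimes> b \<in> carrier G" using a b by blast
  ultimately show "a \<otimes> b \<in> ?Z" by blast
qed auto

section \<open>A finite quotient of the pullback along the abelianization\<close>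

text \<open>The map \<open>q\<close> stands for the abelianization of \<open>G\<close>. Working with any homomorphism that has
  the derived subgroup as its kernel keeps cosets out of the computations.\<close>

locale abelianization_cover = A: comm_group A + group_hom G A q
  for G :: "('a, 'm) monoid_scheme" (structure) and A :: "('b, 'n) monoid_scheme" (structure) and q +
  fixes S :: "'a set" and e :: "'a \<Rightarrow> nat"
  assumes kernel: "kernel G A q = derived G (carrier G)"
    and finD: "finite (derived G (carrier G))"
    and finS: "finite S" and SG: "S \<subseteq> carrier G"
    and derived_S: "\<And>T. S \<subseteq> T \<Longrightarrow> T \<subseteq> carrier G \<Longrightarrow> derived G T = derived G (carrier G)"
    and e_pos: "\<And>s. s \<in> S \<Longrightarrow> 0 < e s"
    and central: "\<And>s y. s \<in> S \<Longrightarrow> y \<in> carrier G \<Longrightarrow> s [^]\<^bsub>G\<^esub> e s \<otimes>\<^bsub>G\<^esub> y = y \<otimes>\<^bsub>G\<^esub> s [^]\<^bsub>G\<^esub> e s"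
begin

text \<open>The center of \<open>G\<close>, as a group in its own right, so that products over \<open>S\<close> of central elements make
  sense.\<close>

definition C where "C = G\<lparr>carrier := {x \<in> carrier G. \<forall>y\<in>carrier G. x \<otimes>\<^bsub>G\<^esub> y = y \<otimes>\<^bsub>G\<^esub> x}\<rparr>"

text \<open>The free abelian group on \<open>S\<close>.\<close>

definition V :: "('a \<Rightarrow> int) set" where "V = {v. \<forall>i. i \<notin> S \<longrightarrow> v i = 0}"

text \<open>The homomorphism from the free abelian group on \<open>S\<close> to \<open>A\<close> that agrees with \<open>q\<close> on \<open>S\<close>.\<close>

definition p :: "('a \<Rightarrow> int) \<Rightarrow> 'b" where "p v = finprod A (\<lambda>s. q s [^]\<^bsub>A\<^esub> v s) S"

text \<open>The homomorphism from the free abelian group on \<open>S\<close> to the center of \<open>G\<close> that sends \<open>s\<close> to its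
  central power.\<close>

definition z :: "('a \<Rightarrow> int) \<Rightarrow> 'a" where "z c = finprod C (\<lambda>s. (s [^]\<^bsub>G\<^esub> e s) [^]\<^bsub>C\<^esub> c s) S"

text \<open>The pullback of \<open>q\<close> and \<open>p\<close>.\<close>

definition K :: "('a \<times> ('a \<Rightarrow> int)) monoid" where
  "K = \<lparr>carrier = {(x, v). x \<in> carrier G \<and> v \<in> V \<and> q x = p v},
        monoid.mult = (\<lambda>(x, v) (y, w). (x \<otimes>\<^bsub>G\<^esub> y, \<lambda>i. v i + w i)), one = (\<one>\<^bsub>G\<^esub>, \<lambda>i. 0)\<rparr>"

text \<open>The subgroup of \<open>K\<close> generated by the lifts of the central powers.\<close>

definition Z :: "('a \<times> ('a \<Rightarrow> int)) set" where
  "Z = (\<lambda>c. (z c, \<lambda>s. int (e s) * c s)) ` V"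

lemma mult_K [simp]: "(x, v) \<otimes>\<^bsub>K\<^esub> (y, w) = (x \<otimes>\<^bsub>G\<^esub> y, \<lambda>i. v i + w i)"
  and one_K [simp]: "\<one>\<^bsub>K\<^esub> = (\<one>\<^bsub>G\<^esub>, \<lambda>i. 0)"
  and carrier_K: "(x, v) \<in> carrier K \<longleftrightarrow> x \<in> carrier G \<and> v \<in> V \<and> q x = p v"
  by (auto simp: K_def)

lemma q_closed: "s \<in> S \<Longrightarrow> q s \<in> carrier A"
  using SG by auto

lemma p_closed: "p v \<in> carrier A"
  unfolding p_def by (intro A.finprod_closed) (auto simp: q_closed)

lemma p_add: "p (\<lambda>i. v i + w i) = p v \<otimes>\<^bsub>A\<^esub> p w"
proof -
  have "p (\<lambda>i. v i + w i) = finprod A (\<lambda>s. q s [^]\<^bsub>A\<^esub> v s \<otimes>\<^bsub>A\<^esub> q s [^]\<^bsub>A\<^esub> w s) S"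
    unfolding p_def by (rule A.finprod_cong') (auto simp: q_closed A.int_pow_mult)
  also have "\<dots> = p v \<otimes>\<^bsub>A\<^esub> p w"
    unfolding p_def by (rule A.finprod_multf) (auto simp: q_closed)
  finally show ?thesis .
qed

lemma p_zero [simp]: "p (\<lambda>i. 0) = \<one>\<^bsub>A\<^esub>"
  by (simp add: p_def)

lemma p_minus: "p (\<lambda>i. - v i) = inv\<^bsub>A\<^esub> p v"
proof (rule A.inv_equality[symmetric, OF _ p_closed p_closed])
  show "p (\<lambda>i. - v i) \<otimes>\<^bsub>A\<^esub> p v = \<one>\<^bsub>A\<^esub>" by (simp flip: p_add)
qed

lemma carrier_C: "carrier C = {x \<in> carrier G. \<forall>y\<in>carrier G. x \<otimes>\<^bsub>G\<^esub> y = y \<otimes>\<^bsub>G\<^esub> x}"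
  and C_simps [simp]: "x \<otimes>\<^bsub>C\<^esub> y = x \<otimes>\<^bsub>G\<^esub> y" "\<one>\<^bsub>C\<^esub> = \<one>\<^bsub>G\<^esub>"
  by (simp_all add: C_def)

lemma C_subset: "x \<in> carrier C \<Longrightarrow> x \<in> carrier G"
  and C_central: "x \<in> carrier C \<Longrightarrow> y \<in> carrier G \<Longrightarrow> x \<otimes>\<^bsub>G\<^esub> y = y \<otimes>\<^bsub>G\<^esub> x"
  unfolding carrier_C by blast+

lemma comm_group_C: "comm_group C"
proof -
  interpret C: group C unfolding C_def by (rule G.subgroup_imp_group[OF G.center_subgroup])
  show ?thesis
    by (rule C.group_comm_groupI) (simp only: C_simps, blast intro: C_central C_subset)
qed

sublocale C: comm_group C by (rule comm_group_C)

lemma power_C: "s \<in> S \<Longrightarrow> s [^]\<^bsub>G\<^esub> e s \<in> carrier C"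
  using SG central unfolding carrier_C by (blast intro: G.nat_pow_closed)

lemma z_closed: "z c \<in> carrier C"
  unfolding z_def by (intro C.finprod_closed) (auto simp: power_C)

lemma z_add: "z (\<lambda>i. c i + d i) = z c \<otimes>\<^bsub>G\<^esub> z d"
proof -
  have "z (\<lambda>i. c i + d i) =
      finprod C (\<lambda>s. (s [^]\<^bsub>G\<^esub> e s) [^]\<^bsub>C\<^esub> c s \<otimes>\<^bsub>C\<^esub> (s [^]\<^bsub>G\<^esub> e s) [^]\<^bsub>C\<^esub> d s) S"
    unfolding z_def by (rule C.finprod_cong') (auto simp: power_C C.int_pow_mult simp del: C_simps)
  also have "\<dots> = z c \<otimes>\<^bsub>C\<^esub> z d"
    unfolding z_def by (rule C.finprod_multf) (auto simp: power_C)
  finally show ?thesis by simp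
qed

lemma z_zero: "z (\<lambda>i. 0) = \<one>\<^bsub>G\<^esub>"
proof -
  have "z (\<lambda>i. 0) = \<one>\<^bsub>C\<^esub>" by (simp add: z_def del: C_simps)
  then show ?thesis by simp
qed

text \<open>Compatibility of the two homomorphisms: this is what places \<open>Z\<close> inside the pullback.\<close>

lemma q_z: "q (z c) = p (\<lambda>s. int (e s) * c s)"
proof -
  have q: "q \<in> hom C A" by (auto simp: hom_def C_subset)
  have "q (z c) = finprod A (\<lambda>s. q ((s [^]\<^bsub>G\<^esub> e s) [^]\<^bsub>C\<^esub> c s)) S"
    unfolding z_def by (rule hom_finprod_comm_group[OF comm_group_C A.comm_group_axioms q])
      (auto simp: power_C)
  also have "\<dots> = p (\<lambda>s. int (e s) * c s)"
    unfolding p_def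
  proof (rule A.finprod_cong')
    fix s assume s: "s \<in> S"
    have "q ((s [^]\<^bsub>G\<^esub> e s) [^]\<^bsub>C\<^esub> c s) = q (s [^]\<^bsub>G\<^esub> e s) [^]\<^bsub>A\<^esub> c s"
      by (rule Group.hom_int_pow[OF q power_C[OF s] C.is_group A.is_group])
    also have "\<dots> = (q s [^]\<^bsub>A\<^esub> int (e s)) [^]\<^bsub>A\<^esub> c s"
      using s SG by (simp add: hom_nat_pow int_pow_int subsetD)
    also have "\<dots> = q s [^]\<^bsub>A\<^esub> (int (e s) * c s)"
      using q_closed[OF s] by (rule A.int_pow_pow)
    finally show "q ((s [^]\<^bsub>G\<^esub> e s) [^]\<^bsub>C\<^esub> c s) = q s [^]\<^bsub>A\<^esub> (int (e s) * c s)" .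
  qed (auto simp: q_closed)
  finally show ?thesis .
qed

lemma group_K: "group K"
proof (rule groupI)
  fix a assume "a \<in> carrier K"
  then obtain x v where a: "a = (x, v)" "x \<in> carrier G" "v \<in> V" "q x = p v"
    by (cases a) (auto simp: carrier_K)
  have "(inv\<^bsub>G\<^esub> x, \<lambda>i. - v i) \<in> carrier K"
    using a by (auto simp: carrier_K V_def p_minus)
  moreover have "(inv\<^bsub>G\<^esub> x, \<lambda>i. - v i) \<otimes>\<^bsub>K\<^esub> a = \<one>\<^bsub>K\<^esub>" using a by simp
  ultimately show "\<exists>b\<in>carrier K. b \<otimes>\<^bsub>K\<^esub> a = \<one>\<^bsub>K\<^esub>" by blast
qed (auto simp: carrier_K V_def p_add G.m_assoc add.assoc)

sublocale K: group K by (rule group_K)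

lemma fst_hom: "group_hom K G fst"
  by unfold_locales (auto simp: hom_def carrier_K)

text \<open>The second projection maps to an abelian group, so it kills commutators.\<close>

lemma derived_K: "(x, v) \<in> derived K (carrier K) \<Longrightarrow> v = (\<lambda>i. 0)"
proof -
  let ?U = "{a \<in> carrier K. snd a = (\<lambda>i. 0)}"
  have inv: "inv\<^bsub>K\<^esub> (x, v) = (inv\<^bsub>G\<^esub> x, \<lambda>i. - v i)" if "(x, v) \<in> carrier K" for x v
    using that by (intro K.inv_equality) (auto simp: carrier_K V_def p_minus)
  have "subgroup ?U K"
    by (rule K.subgroupI) (auto simp: inv V_def carrier_K p_add intro!: exI[of _ "\<one>\<^bsub>G\<^esub>"])
  moreover have "derived_set K (carrier K) \<subseteq> ?U"
  proof -
    have "snd (a \<otimes>\<^bsub>K\<^esub> b \<otimes>\<^bsub>K\<^esub> inv\<^bsub>K\<^esub> a \<otimes>\<^bsub>K\<^esub> inv\<^bsub>K\<^esub> b) = (\<lambda>i. 0)"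
      if "a \<in> carrier K" "b \<in> carrier K" for a b
      using that by (cases a; cases b) (simp add: inv)
    then show ?thesis using K.derived_set_in_carrier[of "carrier K"] by blast
  qed
  ultimately have "derived K (carrier K) \<subseteq> ?U"
    unfolding derived_def by (intro K.generate_subgroup_incl)
  then show "(x, v) \<in> derived K (carrier K) \<Longrightarrow> v = (\<lambda>i. 0)" by auto
qed

lemma S_fst_K: "S \<subseteq> fst ` carrier K"
proof
  fix s assume s: "s \<in> S"
  let ?v = "\<lambda>i. if i = s then 1 else 0 :: int"
  have "p ?v = finprod A (\<lambda>i. if i = s then q i else \<one>\<^bsub>A\<^esub>) S"
    unfolding p_def by (rule A.finprod_cong') (auto simp: q_closed)
  also have "\<dots> = q s"
    by (rule A.finprod_singleton_swap) (auto simp: s finS q_closed)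
  finally have "(s, ?v) \<in> carrier K" using s SG by (auto simp: carrier_K V_def)
  then show "s \<in> fst ` carrier K" by force
qed

text \<open>The first projection need not be onto, but its image contains \<open>S\<close>, which is enough to recover the whole
  derived subgroup.\<close>

lemma fst_derived_K: "fst ` derived K (carrier K) = derived G (carrier G)"
proof -
  interpret fst: group_hom K G fst by (rule fst_hom)
  have "derived G (fst ` carrier K) = fst ` derived K (carrier K)" by (rule fst.derived_img) simp
  moreover have "derived G (fst ` carrier K) = derived G (carrier G)"
    by (rule derived_S[OF S_fst_K]) (auto simp: carrier_K)
  ultimately show ?thesis by simp
qed

lemma inj_fst_derived_K: "inj_on fst (derived K (carrier K))"
  by (auto simp: inj_on_def dest: derived_K)

lemma Z_subset: "Z \<subseteq> carrier K"
  by (auto simp: Z_def carrier_K C_subset[OF z_closed] q_z V_def)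

lemma Z_central: "a \<in> Z \<Longrightarrow> b \<in> carrier K \<Longrightarrow> b \<otimes>\<^bsub>K\<^esub> a = a \<otimes>\<^bsub>K\<^esub> b"
  by (cases b) (auto simp: Z_def carrier_K add.commute C_central[OF z_closed])

lemma Z_normal: "Z \<lhd> K"
proof (rule K.normal_invI)
  show "subgroup Z K"
  proof (rule K.subgroupI[OF Z_subset])
    show "Z \<noteq> {}" by (auto simp: Z_def V_def intro!: exI[of _ "\<lambda>i. 0"])
    show "a \<otimes>\<^bsub>K\<^esub> b \<in> Z" if ab: "a \<in> Z" "b \<in> Z" for a b
    proof -
      obtain c d where cd: "c \<in> V" "d \<in> V" "a = (z c, \<lambda>s. int (e s) * c s)"
          "b = (z d, \<lambda>s. int (e s) * d s)" using ab unfolding Z_def by blast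
      then have "a \<otimes>\<^bsub>K\<^esub> b = (\<lambda>c. (z c, \<lambda>s. int (e s) * c s)) (\<lambda>i. c i + d i)"
        by (simp add: z_add distrib_left)
      moreover have "(\<lambda>i. c i + d i) \<in> V" using cd by (auto simp: V_def)
      ultimately show ?thesis unfolding Z_def by blast
    qed
    show "inv\<^bsub>K\<^esub> a \<in> Z" if a: "a \<in> Z" for a
    proof -
      obtain c where c: "c \<in> V" "a = (z c, \<lambda>s. int (e s) * c s)"
        using a unfolding Z_def by blast
      let ?b = "(\<lambda>c. (z c, \<lambda>s. int (e s) * c s)) (\<lambda>i. - c i)"
      have b: "?b \<in> Z" unfolding Z_def by (rule imageI) (use c in \<open>auto simp: V_def\<close>)
      have "?b \<otimes>\<^bsub>K\<^esub> a = \<one>\<^bsub>K\<^esub>"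
        using c z_add[of "\<lambda>i. - c i" c] by (simp add: z_zero)
      then have "inv\<^bsub>K\<^esub> a = ?b" using b a Z_subset by (intro K.inv_equality) auto
      with b show ?thesis by simp
    qed
  qed
  show "x \<otimes>\<^bsub>K\<^esub> h \<otimes>\<^bsub>K\<^esub> inv\<^bsub>K\<^esub> x \<in> Z" if "x \<in> carrier K" "h \<in> Z" for x h
  proof -
    have "x \<otimes>\<^bsub>K\<^esub> h \<otimes>\<^bsub>K\<^esub> inv\<^bsub>K\<^esub> x = h \<otimes>\<^bsub>K\<^esub> (x \<otimes>\<^bsub>K\<^esub> inv\<^bsub>K\<^esub> x)"
      unfolding Z_central[OF that(2,1)]
      using that Z_subset by (intro K.m_assoc) auto
    also have "\<dots> = h" using that Z_subset by (simp add: subsetD del: one_K)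
    finally show ?thesis using that by simp
  qed
qed

text \<open>The reason for passing to the pullback: the second component of an element of \<open>Z\<close> determines its
  coefficients, since no \<open>e s\<close> is zero.\<close>

lemma Z_inter_derived: "(x, \<lambda>i. 0) \<in> Z \<Longrightarrow> x = \<one>\<^bsub>G\<^esub>"
proof -
  assume "(x, \<lambda>i. 0) \<in> Z"
  then obtain c where c: "c \<in> V" "x = z c" "(\<lambda>i. 0) = (\<lambda>s. int (e s) * c s)"
    by (auto simp: Z_def)
  have "c = (\<lambda>i. 0)"
  proof
    fix i
    have "int (e i) * c i = 0" using fun_cong[OF c(3), of i] by simp
    then show "c i = 0" using e_pos[of i] c(1) by (cases "i \<in> S") (auto simp: V_def)
  qed
  then show ?thesis using c(2) z_zero by simp
qed

sublocale Z: normal Z K by (rule Z_normal)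

lemma quotient_hom: "group_hom K (K Mod Z) (\<lambda>a. Z #>\<^bsub>K\<^esub> a)"
  using Z.factorgroup_is_group Z.r_coset_hom_Mod by (simp add: group_hom_def group_hom_axioms_def)

lemma inj_quotient_derived: "inj_on (\<lambda>a. Z #>\<^bsub>K\<^esub> a) (derived K (carrier K))"
proof (rule inj_onI)
  fix a b assume a: "a \<in> derived K (carrier K)" and b: "b \<in> derived K (carrier K)"
    and eq: "Z #>\<^bsub>K\<^esub> a = Z #>\<^bsub>K\<^esub> b"
  have ca: "a \<in> carrier K" and cb: "b \<in> carrier K"
    using a b K.derived_in_carrier by blast+
  have "a \<in> Z #>\<^bsub>K\<^esub> b" using K.rcos_self[OF ca Z.subgroup_axioms] eq by simp
  then obtain k where k: "k \<in> Z" "a = k \<otimes>\<^bsub>K\<^esub> b" unfolding r_coset_def by blast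
  obtain x y where "a = (x, \<lambda>i. 0)" "b = (y, \<lambda>i. 0)" using a b derived_K by (cases a; cases b) blast
  moreover obtain u w where kk: "k = (u, w)" by (cases k)
  ultimately have w: "w = (\<lambda>i. 0)" and x: "x = u \<otimes>\<^bsub>G\<^esub> y" using k(2) by auto
  have "u = \<one>\<^bsub>G\<^esub>" using Z_inter_derived k(1) kk w by simp
  then show "a = b" using k(2) kk w cb K.l_one[OF cb] by simp
qed

lemma quotient_integral:
  assumes "is_integral G J" shows "is_integral (K Mod Z) J"
proof (rule is_integral_image[OF quotient_hom _ _ inj_quotient_derived])
  show "is_integral K J"
    by (rule is_integral_preimage[OF fst_hom assms inj_fst_derived_K fst_derived_K])
qed (simp add: carrier_FactGroup)

text \<open>Representatives of the second components modulo those of \<open>Z\<close>.\<close>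

definition W :: "('a \<Rightarrow> int) set" where "W = {v \<in> V. \<forall>s\<in>S. 0 \<le> v s \<and> v s < int (e s)}"

lemma card_W: "finite W \<and> card W \<le> (\<Prod>s\<in>S. e s)"
proof -
  let ?P = "\<Pi>\<^sub>E s\<in>S. {0..<int (e s)}"
  have inj: "inj_on (\<lambda>v. restrict v S) W"
  proof (rule inj_onI, rule ext)
    fix v w i assume vw: "v \<in> W" "w \<in> W" "restrict v S = restrict w S"
    show "v i = w i"
    proof (cases "i \<in> S")
      case True then show ?thesis using fun_cong[OF vw(3), of i] by simp
    next
      case False then show ?thesis using vw by (simp add: W_def V_def)
    qed
  qed
  have sub: "(\<lambda>v. restrict v S) ` W \<subseteq> ?P" by (auto simp: W_def)
  have finP: "finite ?P" by (intro finite_PiE finS) auto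
  have "card W \<le> card ?P" by (rule card_inj_on_le[OF inj sub finP])
  moreover have "finite W" by (rule inj_on_finite[OF inj sub finP])
  ultimately show ?thesis by (simp add: card_PiE finS)
qed

text \<open>A nonempty fibre of \<open>q\<close> is a translate of the kernel.\<close>

lemma card_fibre:
  fixes v defines "F \<equiv> {x \<in> carrier G. q x = p v}"
  shows "finite F \<and> card F \<le> card (derived G (carrier G))"
proof (cases "F = {}")
  case False
  then obtain y where y: "y \<in> carrier G" "q y = p v" by (auto simp: F_def)
  have inj: "inj_on (\<lambda>x. x \<otimes>\<^bsub>G\<^esub> inv\<^bsub>G\<^esub> y) F"
    using y by (auto simp: inj_on_def F_def)
  have sub: "(\<lambda>x. x \<otimes>\<^bsub>G\<^esub> inv\<^bsub>G\<^esub> y) ` F \<subseteq> derived G (carrier G)"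
    using y p_closed by (auto simp: F_def kernel[symmetric] kernel_def)
  show ?thesis using card_inj_on_le[OF inj sub finD] inj_on_finite[OF inj sub finD] by simp
qed simp

text \<open>Division with remainder in each coordinate: adding a suitable element of \<open>Z\<close> moves any element of \<open>K\<close>
  to one whose second component lies in \<open>W\<close>.\<close>

lemma quotient_card:
  "finite (carrier (K Mod Z)) \<and>
   card (carrier (K Mod Z)) \<le> card (derived G (carrier G)) * (\<Prod>s\<in>S. e s)"
proof -
  let ?F = "\<lambda>v. {x \<in> carrier G. q x = p v}"
  define R where "R = (\<Union>v\<in>W. ?F v \<times> {v})"
  have finR: "finite R" unfolding R_def using card_W card_fibre by auto
  have "card R \<le> (\<Sum>v\<in>W. card (?F v \<times> {v}))" unfolding R_def using card_W by (intro card_UN_le) simp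
  also have "\<dots> \<le> (\<Sum>v\<in>W. card (derived G (carrier G)))"
    by (intro sum_mono) (use card_fibre in simp)
  also have "\<dots> \<le> card (derived G (carrier G)) * (\<Prod>s\<in>S. e s)" using card_W by simp
  finally have cardR: "card R \<le> card (derived G (carrier G)) * (\<Prod>s\<in>S. e s)" .
  have "carrier (K Mod Z) \<subseteq> (\<lambda>a. Z #>\<^bsub>K\<^esub> a) ` R"
  proof
    fix X assume "X \<in> carrier (K Mod Z)"
    then obtain x v where xv: "(x, v) \<in> carrier K" and X: "X = Z #>\<^bsub>K\<^esub> (x, v)"
      by (auto simp: carrier_FactGroup)
    define c where "c = (\<lambda>s. if s \<in> S then - (v s div int (e s)) else 0)"
    let ?k = "(z c, \<lambda>s. int (e s) * c s)"
    have k: "?k \<in> Z" by (auto simp: Z_def V_def c_def)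
    have r: "?k \<otimes>\<^bsub>K\<^esub> (x, v) \<in> Z #>\<^bsub>K\<^esub> (x, v)" using k unfolding r_coset_def by blast
    have rK: "?k \<otimes>\<^bsub>K\<^esub> (x, v) \<in> carrier K" using k xv Z_subset by blast
    have mod: "int (e s) * c s + v s = v s mod int (e s)" if "s \<in> S" for s
      using that by (simp add: c_def minus_mult_div_eq_mod[symmetric])
    have "?k \<otimes>\<^bsub>K\<^esub> (x, v) \<in> R"
      using rK e_pos by (auto simp: R_def W_def carrier_K mod)
    moreover have "X = Z #>\<^bsub>K\<^esub> (?k \<otimes>\<^bsub>K\<^esub> (x, v))"
      unfolding X by (rule K.repr_independence[OF r xv Z.subgroup_axioms])
    ultimately show "X \<in> (\<lambda>a. Z #>\<^bsub>K\<^esub> a) ` R" by blast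
  qed
  then show ?thesis
    using surj_card_le[OF finR] cardR finite_surj[OF finR] by (meson order_trans)
qed

end

section \<open>Bounded integrals\<close>

text \<open>Transport of the structure along an enumeration of the carrier.\<close>

lemma (in group) ex_nat_copy:
  assumes "finite (carrier G)"
  obtains M :: "nat monoid" and f where "carrier M = {0..<card (carrier G)}" "group_hom G M f"
    "f ` carrier G = carrier M" "inj_on f (carrier G)"
proof -
  obtain f where f: "bij_betw f (carrier G) {0..<card (carrier G)}"
    using ex_bij_betw_finite_nat[OF assms] by blast
  define g where "g = inv_into (carrier G) f"
  define M where "M = \<lparr>carrier = {0..<card (carrier G)}, monoid.mult = (\<lambda>i j. f (g i \<otimes> g j)), one = f \<one>\<rparr>"
  have gf: "g (f x) = x" if "x \<in> carrier G" for x
    using bij_betw_inv_into_left[OF f that] by (simp add: g_def)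
  have hom: "f \<in> hom G M"
    using f by (auto simp: hom_def M_def gf bij_betw_def)
  have "f \<in> iso G M" using hom f by (intro isoI) (auto simp: M_def)
  then have "group (M\<lparr>one := f \<one>\<rparr>)" by (rule iso_imp_img_group)
  then have "group M" by (simp add: M_def)
  then have "group_hom G M f" using hom is_group by (simp add: group_hom_def group_hom_axioms_def)
  then show ?thesis using f by (intro that[of M f]) (auto simp: M_def bij_betw_def)
qed

definition integral_bound :: "nat \<Rightarrow> nat" where
  "integral_bound n = n * (n * n ^ n) ^ (2 * n)"

text \<open>The integral is \<open>K / Z\<close> for the abelianization of \<open>H\<close>, moved to an initial segment of the
  natural numbers.\<close>

theorem bounded_integral:
  assumes int: "is_integral H G" and fin: "finite (carrier G)"
  shows "\<exists>(M :: nat monoid) N. carrier M = {0..<N} \<and> N \<le> integral_bound (card (carrier G)) \<and>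
    is_integral M G"
proof -
  interpret H: group H using int by (simp add: is_integral_def)
  let ?D = "derived H (carrier H)"
  define n where "n = card (carrier G)"
  have iso: "H\<lparr>carrier := ?D\<rparr> \<cong> G" using int by (simp add: is_integral_def)
  have finD: "finite ?D" using iso_finite[OF iso] fin by simp
  have n: "n = card ?D" using iso_same_card[OF iso] by (simp add: n_def)
  interpret D: normal ?D H by (rule H.derived_self_is_normal)
  have "?D \<noteq> {}" using D.one_closed by blast
  then have n_pos: "0 < n" unfolding n using finD by (simp add: card_gt_0_iff)
  obtain S where S: "finite S" "S \<subseteq> carrier H" "card S \<le> 2 * card ?D"
      "\<forall>T. S \<subseteq> T \<longrightarrow> T \<subseteq> carrier H \<longrightarrow> derived H T = ?D"
    by (rule H.finite_derived_generators[OF finD])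
  have "\<exists>e::nat. 0 < e \<and> e \<le> n * n ^ n \<and> (\<forall>y\<in>carrier H. s [^]\<^bsub>H\<^esub> e \<otimes>\<^bsub>H\<^esub> y = y \<otimes>\<^bsub>H\<^esub> s [^]\<^bsub>H\<^esub> e)"
    if "s \<in> S" for s
    by (rule H.power_central[OF finD _ n, of s]) (use that S(2) in auto)
  then obtain e :: "_ \<Rightarrow> nat" where e: "\<And>s. s \<in> S \<Longrightarrow> 0 < e s \<and> e s \<le> n * n ^ n \<and>
      (\<forall>y\<in>carrier H. s [^]\<^bsub>H\<^esub> e s \<otimes>\<^bsub>H\<^esub> y = y \<otimes>\<^bsub>H\<^esub> s [^]\<^bsub>H\<^esub> e s)"
    by metis
  have hom: "group_hom H (H Mod ?D) (\<lambda>x. ?D #>\<^bsub>H\<^esub> x)"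
    using D.factorgroup_is_group D.r_coset_hom_Mod by (simp add: group_hom_def group_hom_axioms_def)
  have ker: "kernel H (H Mod ?D) (\<lambda>x. ?D #>\<^bsub>H\<^esub> x) = ?D"
    using H.coset_join1[OF _ _ D.subgroup_axioms] H.coset_join2[OF _ D.subgroup_axioms] D.subset
    by (auto simp: kernel_def)
  interpret abelianization_cover H "H Mod ?D" "\<lambda>x. ?D #>\<^bsub>H\<^esub> x" S e
    by (intro abelianization_cover.intro hom H.derived_quot_is_comm_group
        abelianization_cover_axioms.intro ker finD S(1,2)) (use S(4) e in blast)+
  let ?Q = "K Mod Z"
  have Q: "is_integral ?Q G" by (rule quotient_integral[OF int])
  then interpret Q: group ?Q by (simp add: is_integral_def)
  have "(\<Prod>s\<in>S. e s) \<le> (n * n ^ n) ^ card S"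
    using e prod_mono[of S e "\<lambda>_. n * n ^ n"] by simp
  also have "\<dots> \<le> (n * n ^ n) ^ (2 * n)" using S(3) n n_pos by (intro power_increasing) auto
  finally have "card (carrier ?Q) \<le> integral_bound n"
    using quotient_card n unfolding integral_bound_def by (meson le_trans mult_le_mono2)
  moreover obtain M :: "nat monoid" and f where M: "carrier M = {0..<card (carrier ?Q)}"
      "group_hom ?Q M f" "f ` carrier ?Q = carrier M" "inj_on f (carrier ?Q)"
    using Q.ex_nat_copy quotient_card by blast
  moreover have "is_integral M G"
    by (rule is_integral_image[OF M(2) Q M(3)])
      (use M(4) Q.derived_in_carrier inj_on_subset in blast)
  ultimately show ?thesis unfolding n_def by blast
qed

section \<open>Multiplication tables as digit sequences\<close>

text \<open>A multiplication table is the digit sequence of its entries, row by row.\<close>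

definition digit_mult :: "nat \<Rightarrow> nat \<Rightarrow> nat \<Rightarrow> nat \<Rightarrow> nat" where
  "digit_mult n t i j = digit n t (i * n + j)"

definition digit_group :: "nat \<Rightarrow> nat \<Rightarrow> nat \<Rightarrow> nat monoid" where
  "digit_group n t e = \<lparr>carrier = {0..<n}, monoid.mult = digit_mult n t, one = e\<rparr>"

lemma digit_group_simps [simp]:
  "carrier (digit_group n t e) = {0..<n}"
  "i \<otimes>\<^bsub>digit_group n t e\<^esub> j = digit_mult n t i j"
  "\<one>\<^bsub>digit_group n t e\<^esub> = e"
  by (simp_all add: digit_group_def)

lemma digit_mult_less: "i < n \<Longrightarrow> digit_mult n t i j < n"
  by (simp add: digit_mult_def digit_less)

lemma computable_digit_mult [computable_rules]:
  assumes "computable k n" "computable k t" "computable k i" "computable k j"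
  shows "computable k (\<lambda>xs. digit_mult (n xs) (t xs) (i xs) (j xs))"
  unfolding digit_mult_def by (intro computable_rules assms)

text \<open>Closure holds automatically, since digits are smaller than the base.\<close>

lemma group_digit_group_iff:
  "group (digit_group n t e) \<longleftrightarrow> e < n \<and> (\<forall>i<n. digit_mult n t e i = i) \<and>
    (\<forall>i<n. \<exists>j<n. digit_mult n t j i = e) \<and>
    (\<forall>i<n. \<forall>j<n. \<forall>k<n. digit_mult n t (digit_mult n t i j) k = digit_mult n t i (digit_mult n t j k))"
  (is "group ?G \<longleftrightarrow> ?R")
proof
  assume "group ?G"
  then interpret group ?G .
  show ?R
  proof (intro conjI allI impI)
    show "e < n" using one_closed by simp
    show "digit_mult n t e i = i" if "i < n" for i using l_one[of i] that by simp
    show "\<exists>j<n. digit_mult n t j i = e" if "i < n" for i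
      using inv_closed[of i] l_inv[of i] that by auto
    show "digit_mult n t (digit_mult n t i j) k = digit_mult n t i (digit_mult n t j k)"
      if "i < n" "j < n" "k < n" for i j k using m_assoc[of i j k] that by simp
  qed
next
  assume ?R
  then show "group ?G"
    by (intro groupI) (auto simp: digit_mult_less Bex_def)
qed

lemma decidable_group_digit_group [computable_rules]:
  assumes "computable k n" "computable k t" "computable k e"
  shows "decidable k (\<lambda>xs. group (digit_group (n xs) (t xs) (e xs)))"
proof (rule computable_subst3[OF _ assms])
  show "decidable 3 (\<lambda>xs. group (digit_group (xs ! 0) (xs ! 1) (xs ! 2)))"
    unfolding group_digit_group_iff by (intro computable_rules) simp_all
qed

lemma ex_digit_group:
  fixes G :: "nat monoid"
  assumes G: "group G" and carrier: "carrier G = {0..<n}"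
  shows "\<exists>t<n ^ (n * n). \<exists>e<n. group (digit_group n t e) \<and> id \<in> iso G (digit_group n t e) \<and>
    (\<forall>i<n. \<forall>j<n. digit_mult n t i j = i \<otimes>\<^bsub>G\<^esub> j)"
proof -
  interpret group G by (rule G)
  have e: "\<one>\<^bsub>G\<^esub> < n" using one_closed carrier by simp
  have closed: "i \<otimes>\<^bsub>G\<^esub> j < n" if "i < n" "j < n" for i j
    using m_closed[of i j] that carrier by simp
  have "\<exists>t<n ^ (n * n). \<forall>q<n * n. digit n t q = (q div n) \<otimes>\<^bsub>G\<^esub> (q mod n)"
    by (rule ex_digits) (use e in \<open>auto intro!: closed simp: less_mult_imp_div_less\<close>)
  then obtain t where t: "t < n ^ (n * n)"
      and digit: "\<And>q. q < n * n \<Longrightarrow> digit n t q = (q div n) \<otimes>\<^bsub>G\<^esub> (q mod n)"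
    by blast
  have mult: "digit_mult n t i j = i \<otimes>\<^bsub>G\<^esub> j" if "i < n" "j < n" for i j
  proof -
    have "i * n + j < Suc i * n" using that by simp
    also have "\<dots> \<le> n * n" using that by (intro mult_right_mono) auto
    finally show ?thesis using digit[of "i * n + j"] that by (simp add: digit_mult_def)
  qed
  have iso: "id \<in> iso G (digit_group n t \<one>\<^bsub>G\<^esub>)"
    by (rule isoI) (auto simp: hom_def carrier mult closed)
  have "group (digit_group n t \<one>\<^bsub>G\<^esub>)"
    using iso_imp_img_group[OF iso] by (simp add: digit_group_def)
  with iso t e mult show ?thesis by blast
qed

lemma concat_rows:
  "[f (i * n + j). i \<leftarrow> [0..<m], j \<leftarrow> [0..<n]] = map f [0..<m * n]"
proof (induction m)
  case (Suc m)
  have "[0..<Suc m * n] = [0..<m * n] @ map (\<lambda>j. m * n + j) [0..<n]"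
    using upt_add_eq_append[of 0 "m * n" n] map_add_upt[of "m * n" n] by (simp add: add.commute)
  with Suc show ?case by simp
qed simp

definition digit_code :: "nat \<Rightarrow> nat \<Rightarrow> nat" where
  "digit_code n t = list_encode (n # map (digit n t) [0..<n * n])"

lemma table_code_digit:
  assumes "carrier G = {0..<n}" "\<And>i j. i < n \<Longrightarrow> j < n \<Longrightarrow> digit_mult n t i j = i \<otimes>\<^bsub>G\<^esub> j"
  shows "table_code G = digit_code n t"
proof -
  have "[i \<otimes>\<^bsub>G\<^esub> j. i \<leftarrow> [0..<n], j \<leftarrow> [0..<n]] = [digit n t (i * n + j). i \<leftarrow> [0..<n], j \<leftarrow> [0..<n]]"
    using assms(2) by (intro arg_cong[of _ _ concat] map_cong refl) (auto simp: digit_mult_def)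
  then show ?thesis
    by (simp only: table_code_def digit_code_def order_def assms(1) card_atLeastLessThan diff_zero concat_rows)
qed

text \<open>The code of a list is built from its end, so the recursion runs through the entries backwards.\<close>

lemma rec_nat_list_encode:
  "k \<le> M \<Longrightarrow> rec_nat 0 (\<lambda>n r. Suc (triangle (f (M - Suc n) + r) + f (M - Suc n))) k =
    list_encode (map f [M - k..<M])"
proof (induction k)
  case (Suc k)
  then have "[M - Suc k..<M] = (M - Suc k) # [M - k..<M]"
    by (subst upt_conv_Cons) (auto simp: Suc_diff_Suc)
  with Suc show ?case by (simp add: prod_encode_def)
qed simp

lemma computable_triangle [computable_rules]:
  assumes "computable k f" shows "computable k (\<lambda>xs. triangle (f xs))"
  unfolding triangle_def by (intro computable_rules assms)

lemma computable_digit_code [computable_rules]: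
  assumes "computable k n" "computable k t"
  shows "computable k (\<lambda>xs. digit_code (n xs) (t xs))"
proof (rule computable_subst2[OF _ assms])
  have eq: "digit_code n t = Suc (triangle (n + c) + n)"
    if "c = rec_nat 0 (\<lambda>i r. Suc (triangle (digit n t (n * n - Suc i) + r) + digit n t (n * n - Suc i))) (n * n)"
    for n t c
    unfolding that digit_code_def
    by (simp add: rec_nat_list_encode[of _ "n * n" "digit n t"] prod_encode_def)
  show "computable 2 (\<lambda>xs. digit_code (xs ! 0) (xs ! 1))"
    unfolding eq[OF refl] by (intro computable_rec_nat computable_rules) simp_all
qed

section \<open>Integrals by bounded quantifiers\<close>

lemma is_integral_iff_mono:
  assumes G: "group G" and M: "group M"
  shows "is_integral M G \<longleftrightarrow>
    (\<exists>f\<in>hom G M. inj_on f (carrier G) \<and> f ` carrier G = derived M (carrier M))"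
proof -
  let ?D = "M\<lparr>carrier := derived M (carrier M)\<rparr>"
  interpret M: group M by (rule M)
  have D: "group ?D" by (simp add: M.derived_is_subgroup M.subgroup_imp_group)
  have "is_integral M G \<longleftrightarrow> G \<cong> ?D"
    unfolding is_integral_def using M group.iso_sym[OF G] group.iso_sym[OF D] by blast
  also have "\<dots> \<longleftrightarrow> (\<exists>f\<in>hom G M. inj_on f (carrier G) \<and> f ` carrier G = derived M (carrier M))"
    using M.derived_in_carrier[of "carrier M"]
    by (auto simp: is_iso_def iso_def hom_def bij_betw_def Pi_iff) (metis imageI subsetD)+
  finally show ?thesis .
qed

text \<open>A way to recognize commutators without inverses, which a multiplication table does not
  provide directly.\<close>

lemma (in group) commutator_eq_iff:
  assumes "c \<in> carrier G" "x \<in> carrier G" "y \<in> carrier G"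
  shows "c = x \<otimes> y \<otimes> inv x \<otimes> inv y \<longleftrightarrow> c \<otimes> (y \<otimes> x) = x \<otimes> y"
proof -
  have "c = x \<otimes> y \<otimes> inv x \<otimes> inv y \<longleftrightarrow> c = x \<otimes> y \<otimes> inv (y \<otimes> x)"
    using assms by (simp add: inv_mult_group m_assoc)
  also have "\<dots> \<longleftrightarrow> c \<otimes> (y \<otimes> x) = x \<otimes> y"
    using assms by (metis inv_solve_right m_closed)
  finally show ?thesis .
qed

text \<open>The derived subgroup is the least subgroup that contains all commutators. Both inclusions are spelled
  out using only products and quantifiers over elements and subsets; the conditions on \<open>U\<close>
  say that it is a subgroup containing the commutators.\<close>

lemma (in group) eq_derived_iff:
  assumes "subgroup I G"
  shows "I = derived G (carrier G) \<longleftrightarrow>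
    (\<forall>x\<in>carrier G. \<forall>y\<in>carrier G. \<exists>c\<in>I. c \<otimes> (y \<otimes> x) = x \<otimes> y) \<and>
    (\<forall>U\<subseteq>carrier G. (\<forall>x\<in>carrier G. \<forall>y\<in>carrier G. \<forall>c\<in>carrier G. c \<otimes> (y \<otimes> x) = x \<otimes> y \<longrightarrow> c \<in> U) \<and>
        (\<forall>x\<in>U. \<forall>y\<in>U. x \<otimes> y \<in> U) \<and> (\<forall>x\<in>U. \<forall>y\<in>carrier G. x \<otimes> y = \<one> \<longrightarrow> y \<in> U) \<longrightarrow> I \<subseteq> U)"
    (is "_ \<longleftrightarrow> ?A \<and> ?B")
proof -
  let ?D = "derived G (carrier G)" and ?C = "derived_set G (carrier G)"
  have D: "subgroup ?D G" by (simp add: derived_is_subgroup)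
  have CD: "?C \<subseteq> ?D" unfolding derived_def by (auto intro: generate.incl)
  have comm: "x \<otimes> y \<otimes> inv x \<otimes> inv y \<otimes> (y \<otimes> x) = x \<otimes> y" if "x \<in> carrier G" "y \<in> carrier G" for x y
    using commutator_eq_iff[of "x \<otimes> y \<otimes> inv x \<otimes> inv y" x y] that by simp
  have A: "?A \<longleftrightarrow> ?D \<subseteq> I"
  proof
    assume L: ?A
    have "?C \<subseteq> I"
    proof safe
      fix x y assume xy: "x \<in> carrier G" "y \<in> carrier G"
      then obtain c where c: "c \<in> I" "c \<otimes> (y \<otimes> x) = x \<otimes> y" using L by blast
      then show "x \<otimes> y \<otimes> inv x \<otimes> inv y \<in> I"
        using commutator_eq_iff[of c x y] xy subgroup.mem_carrier[OF assms] by metis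
    qed
    then show "?D \<subseteq> I" unfolding derived_def by (rule generate_subgroup_incl[OF _ assms])
  next
    assume "?D \<subseteq> I"
    then have "x \<otimes> y \<otimes> inv x \<otimes> inv y \<in> I" if "x \<in> carrier G" "y \<in> carrier G" for x y
      using CD that by blast
    then show ?A using comm by blast
  qed
  have B: "?B \<longleftrightarrow> I \<subseteq> ?D"
  proof
    assume L: ?B
    have C: "c \<in> ?D" if "x \<in> carrier G" "y \<in> carrier G" "c \<in> carrier G" "c \<otimes> (y \<otimes> x) = x \<otimes> y" for x y c
      using that CD commutator_eq_iff[of c x y] by blast
    have inv: "y \<in> ?D" if "x \<in> ?D" "y \<in> carrier G" "x \<otimes> y = \<one>" for x y
      using that subgroup.m_inv_closed[OF D that(1)] inv_inv
        subgroup.mem_carrier[OF D that(1)] by (metis inv_equality)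
    show "I \<subseteq> ?D"
    proof (rule mp[OF L[THEN spec, THEN mp, OF subgroup.subset[OF D]]], intro conjI ballI impI)
      show "c \<in> ?D" if "x \<in> carrier G" "y \<in> carrier G" "c \<in> carrier G" "c \<otimes> (y \<otimes> x) = x \<otimes> y" for x y c
        by (rule C[OF that])
      show "x \<otimes> y \<in> ?D" if "x \<in> ?D" "y \<in> ?D" for x y by (rule subgroup.m_closed[OF D that])
      show "y \<in> ?D" if "x \<in> ?D" "y \<in> carrier G" "x \<otimes> y = \<one>" for x y by (rule inv[OF that])
    qed
  next
    assume L: "I \<subseteq> ?D"
    show ?B
    proof (intro allI impI)
      fix U assume sub: "U \<subseteq> carrier G" and U: "(\<forall>x\<in>carrier G. \<forall>y\<in>carrier G. \<forall>c\<in>carrier G. c \<otimes> (y \<otimes> x) = x \<otimes> y \<longrightarrow> c \<in> U) \<and>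
        (\<forall>x\<in>U. \<forall>y\<in>U. x \<otimes> y \<in> U) \<and> (\<forall>x\<in>U. \<forall>y\<in>carrier G. x \<otimes> y = \<one> \<longrightarrow> y \<in> U)"
      have C: "?C \<subseteq> U"
      proof safe
        fix x y assume "x \<in> carrier G" "y \<in> carrier G"
        then show "x \<otimes> y \<otimes> inv x \<otimes> inv y \<in> U" using U comm[of x y] by simp
      qed
      have "subgroup U G"
      proof (rule subgroupI[OF sub])
        show "U \<noteq> {}" using C one_closed by blast
        show "inv a \<in> U" if "a \<in> U" for a
          using U that sub r_inv[of a] inv_closed[of a] by blast
        show "a \<otimes> b \<in> U" if "a \<in> U" "b \<in> U" for a b using U that by blast
      qed
      then have "?D \<subseteq> U" unfolding derived_def by (rule generate_subgroup_incl[OF C])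
      with L show "I \<subseteq> U" by blast
    qed
  qed
  show ?thesis unfolding A B by (simp only: set_eq_subset conj_commute)
qed

text \<open>The digits of \<open>w\<close> are the values of an injective homomorphism, from the group with table \<open>t\<close> to the
  group with table \<open>u\<close> and neutral element \<open>e\<close>, whose image is the derived subgroup. Subsets are
  coded by the binary digits of \<open>s\<close>, and the last two conjuncts are those of \<open>eq_derived_iff\<close>.\<close>

definition integral_witness :: "nat \<Rightarrow> nat \<Rightarrow> nat \<Rightarrow> nat \<Rightarrow> nat \<Rightarrow> nat \<Rightarrow> bool" where
  "integral_witness n t N u e w \<longleftrightarrow>
    (\<forall>i<n. \<forall>j<n. digit N w (digit_mult n t i j) = digit_mult N u (digit N w i) (digit N w j)) \<and>
    (\<forall>i<n. \<forall>j<n. digit N w i = digit N w j \<longrightarrow> i = j) \<and>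
    (\<forall>x<N. \<forall>y<N. \<exists>i<n. digit_mult N u (digit N w i) (digit_mult N u y x) = digit_mult N u x y) \<and>
    (\<forall>s<2 ^ N.
      (\<forall>x<N. \<forall>y<N. \<forall>c<N. digit_mult N u c (digit_mult N u y x) = digit_mult N u x y \<longrightarrow> digit 2 s c = 1) \<and>
      (\<forall>x<N. digit 2 s x = 1 \<longrightarrow> (\<forall>y<N. digit 2 s y = 1 \<longrightarrow> digit 2 s (digit_mult N u x y) = 1)) \<and>
      (\<forall>x<N. digit 2 s x = 1 \<longrightarrow> (\<forall>y<N. digit_mult N u x y = e \<longrightarrow> digit 2 s y = 1)) \<longrightarrow>
      (\<forall>i<n. digit 2 s (digit N w i) = 1))"

lemma decidable_integral_witness [computable_rules]:
  assumes "computable k n" "computable k t" "computable k N" "computable k u" "computable k e" "computable k w"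
  shows "decidable k (\<lambda>xs. integral_witness (n xs) (t xs) (N xs) (u xs) (e xs) (w xs))"
proof (rule computable_subst6[OF _ assms])
  show "decidable 6 (\<lambda>xs. integral_witness (xs ! 0) (xs ! 1) (xs ! 2) (xs ! 3) (xs ! 4) (xs ! 5))"
    unfolding integral_witness_def by (intro computable_rules) simp_all
qed

lemma all_subsets_digits:
  "(\<forall>U\<subseteq>{0..<N}. P U) \<longleftrightarrow> (\<forall>s<2 ^ N. P {x. x < N \<and> digit 2 s x = 1})"
proof
  assume R: "\<forall>s<2 ^ N. P {x. x < N \<and> digit 2 s x = 1}"
  show "\<forall>U\<subseteq>{0..<N}. P U"
  proof (intro allI impI)
    fix U assume U: "U \<subseteq> {0..<N}"
    have "\<exists>s<2 ^ N. \<forall>x<N. digit 2 s x = of_bool (x \<in> U)"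
      by (rule ex_digits) (simp add: of_bool_def)
    then obtain s where s: "s < 2 ^ N" "\<forall>x<N. digit 2 s x = of_bool (x \<in> U)" by blast
    then have "{x. x < N \<and> digit 2 s x = 1} = U" using U by (auto simp: of_bool_def split: if_splits)
    with R s(1) show "P U" by metis
  qed
next
  assume L: "\<forall>U\<subseteq>{0..<N}. P U"
  show "\<forall>s<2 ^ N. P {x. x < N \<and> digit 2 s x = 1}"
    by (intro allI impI L[rule_format]) auto
qed

lemma is_integral_digit_group_iff:
  assumes G: "group (digit_group n t e)" and M: "group (digit_group N u d)"
  shows "is_integral (digit_group N u d) (digit_group n t e) \<longleftrightarrow>
    (\<exists>w<N ^ n. integral_witness n t N u d w)"
proof -
  let ?G = "digit_group n t e" and ?M = "digit_group N u d"
  interpret G: group ?G by (rule G)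
  interpret M: group ?M by (rule M)
  have N: "0 < N" using M.one_closed by simp
  have key: "w < N ^ n \<Longrightarrow> integral_witness n t N u d w \<longleftrightarrow> digit N w \<in> hom ?G ?M \<and>
      inj_on (digit N w) (carrier ?G) \<and> digit N w ` carrier ?G = derived ?M (carrier ?M)" for w
  proof -
    have hom: "(\<forall>i<n. \<forall>j<n. digit N w (digit_mult n t i j) = digit_mult N u (digit N w i) (digit N w j)) \<longleftrightarrow>
      digit N w \<in> hom ?G ?M"
      by (auto simp: hom_def digit_less N)
    have inj: "(\<forall>i<n. \<forall>j<n. digit N w i = digit N w j \<longrightarrow> i = j) \<longleftrightarrow> inj_on (digit N w) (carrier ?G)"
      by (auto simp: inj_on_def)
    have img: "digit N w ` carrier ?G = derived ?M (carrier ?M) \<longleftrightarrow>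
      (\<forall>x<N. \<forall>y<N. \<exists>i<n. digit_mult N u (digit N w i) (digit_mult N u y x) = digit_mult N u x y) \<and>
      (\<forall>s<2 ^ N.
        (\<forall>x<N. \<forall>y<N. \<forall>c<N. digit_mult N u c (digit_mult N u y x) = digit_mult N u x y \<longrightarrow> digit 2 s c = 1) \<and>
        (\<forall>x<N. digit 2 s x = 1 \<longrightarrow> (\<forall>y<N. digit 2 s y = 1 \<longrightarrow> digit 2 s (digit_mult N u x y) = 1)) \<and>
        (\<forall>x<N. digit 2 s x = 1 \<longrightarrow> (\<forall>y<N. digit_mult N u x y = d \<longrightarrow> digit 2 s y = 1)) \<longrightarrow>
        (\<forall>i<n. digit 2 s (digit N w i) = 1))" if "digit N w \<in> hom ?G ?M"
    proof -
      interpret group_hom ?G ?M "digit N w" by unfold_locales (rule that)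
      have sub: "subgroup (digit N w ` carrier ?G) ?M" by (rule img_is_subgroup)
      show ?thesis
        unfolding M.eq_derived_iff[OF sub] unfolding digit_group_simps all_subsets_digits
        by (simp add: Ball_def Bex_def image_subset_iff digit_less N digit_mult_less imp_conjL cong: imp_cong)
    qed
    show ?thesis by (simp only: integral_witness_def hom inj img cong: conj_cong)
  qed
  show ?thesis
  proof
    assume "is_integral ?M ?G"
    then obtain f where f: "f \<in> hom ?G ?M" "inj_on f (carrier ?G)" "f ` carrier ?G = derived ?M (carrier ?M)"
      using is_integral_iff_mono[OF G M] by blast
    have "f i < N" if "i < n" for i using f(1) that by (auto simp: hom_def Pi_iff)
    then obtain w where w: "w < N ^ n" "\<forall>i<n. digit N w i = f i" using ex_digits[of n f N] by blast
    then have fw: "\<And>i. i \<in> carrier ?G \<Longrightarrow> f i = digit N w i" by simp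
    have "digit N w \<in> hom ?G ?M"
    proof (rule homI)
      fix x y assume xy: "x \<in> carrier ?G" "y \<in> carrier ?G"
      show "digit N w x \<in> carrier ?M" by (simp add: digit_less N)
      show "digit N w (x \<otimes>\<^bsub>?G\<^esub> y) = digit N w x \<otimes>\<^bsub>?M\<^esub> digit N w y"
        by (simp only: fw[OF xy(1), symmetric] fw[OF xy(2), symmetric]
            fw[OF G.m_closed[OF xy], symmetric] hom_mult[OF f(1) xy])
    qed
    moreover have "inj_on (digit N w) (carrier ?G)" by (rule iffD1[OF inj_on_cong[OF fw] f(2)])
    moreover have "digit N w ` carrier ?G = derived ?M (carrier ?M)"
      by (rule trans[OF image_cong[OF refl fw, symmetric] f(3)])
    ultimately show "\<exists>w<N ^ n. integral_witness n t N u d w" using key[OF w(1)] w(1) by blast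
  next
    assume "\<exists>w<N ^ n. integral_witness n t N u d w"
    then show "is_integral ?M ?G" using key is_integral_iff_mono[OF G M] by blast
  qed
qed

section \<open>Decidability of integrability\<close>

definition has_bounded_integral :: "nat \<Rightarrow> nat \<Rightarrow> bool" where
  "has_bounded_integral n t \<longleftrightarrow> (\<exists>N<Suc (integral_bound n). \<exists>u<N ^ (N * N). \<exists>e<N.
     group (digit_group N u e) \<and> (\<exists>w<N ^ n. integral_witness n t N u e w))"

lemma decidable_has_bounded_integral [computable_rules]:
  assumes "computable k n" "computable k t"
  shows "decidable k (\<lambda>xs. has_bounded_integral (n xs) (t xs))"
proof (rule computable_subst2[OF _ assms])
  show "decidable 2 (\<lambda>xs. has_bounded_integral (xs ! 0) (xs ! 1))"
    unfolding has_bounded_integral_def integral_bound_def by (intro computable_rules) simp_all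
qed

lemma is_integral_iso: "is_integral H G \<Longrightarrow> G \<cong> G' \<Longrightarrow> is_integral H G'"
  unfolding is_integral_def by (blast intro: iso_trans)

lemma integrable_digit_group:
  assumes G: "group (digit_group n t e)"
  shows "integrable_in TYPE(nat) (digit_group n t e) \<longleftrightarrow> has_bounded_integral n t"
proof
  assume "integrable_in TYPE(nat) (digit_group n t e)"
  then obtain H :: "nat monoid" where H: "is_integral H (digit_group n t e)"
    unfolding integrable_in_def by blast
  obtain M :: "nat monoid" and N where M: "carrier M = {0..<N}" "N \<le> integral_bound n"
      "is_integral M (digit_group n t e)"
    using bounded_integral[OF H] by auto
  have gM: "group M" using M(3) by (simp add: is_integral_def)
  obtain u d where ud: "u < N ^ (N * N)" "d < N" "group (digit_group N u d)"
      "id \<in> iso M (digit_group N u d)"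
    using ex_digit_group[OF gM M(1)] by blast
  have "group_hom M (digit_group N u d) id"
    using gM ud by (simp add: group_hom_def group_hom_axioms_def iso_def)
  then have "is_integral (digit_group N u d) (digit_group n t e)"
    by (rule is_integral_image[OF _ M(3)]) (auto simp: M(1))
  with M(2) ud show "has_bounded_integral n t"
    unfolding has_bounded_integral_def is_integral_digit_group_iff[OF G ud(3)]
    by (auto simp: less_Suc_eq_le)
next
  assume "has_bounded_integral n t"
  then show "integrable_in TYPE(nat) (digit_group n t e)"
    unfolding has_bounded_integral_def integrable_in_def using is_integral_digit_group_iff[OF G] by blast
qed

text \<open>The order \<open>n\<close> can be bounded by \<open>z\<close>, because it is the first entry of the list coded by \<open>z\<close>.\<close>

lemma table_code_set:
  "{table_code G | G :: nat monoid. table_group G \<and> integrable_in TYPE(nat) G} =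
   {z. \<exists>n<Suc z. \<exists>t<n ^ (n * n). \<exists>e<n. z = digit_code n t \<and> group (digit_group n t e) \<and>
      has_bounded_integral n t}" (is "?L = ?R")
proof (intro equalityI subsetI)
  fix z assume "z \<in> ?L"
  then obtain G :: "nat monoid" and n where z: "z = table_code G" and G: "group G" "carrier G = {0..<n}"
      and int: "integrable_in TYPE(nat) G"
    by (auto simp: table_group_def)
  obtain t e where te: "t < n ^ (n * n)" "e < n" "group (digit_group n t e)"
      "id \<in> iso G (digit_group n t e)" "\<forall>i<n. \<forall>j<n. digit_mult n t i j = i \<otimes>\<^bsub>G\<^esub> j"
    using ex_digit_group[OF G] by blast
  have "integrable_in TYPE(nat) (digit_group n t e)"
    using int is_integral_iso is_isoI[OF te(4)] unfolding integrable_in_def by blast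
  then have "has_bounded_integral n t" using integrable_digit_group[OF te(3)] by simp
  moreover have "z = digit_code n t" unfolding z using G(2) te(5) by (intro table_code_digit) auto
  moreover have "n \<le> digit_code n t"
    using le_prod_encode_1 by (simp add: digit_code_def le_SucI)
  ultimately show "z \<in> ?R" using te by (auto simp: less_Suc_eq_le)
next
  fix z assume "z \<in> ?R"
  then obtain n t e where z: "z = digit_code n t" and G: "group (digit_group n t e)"
      and int: "has_bounded_integral n t" by blast
  have "z = table_code (digit_group n t e)" unfolding z by (intro table_code_digit[symmetric]) auto
  moreover have "table_group (digit_group n t e)" using G by (auto simp: table_group_def)
  ultimately show "z \<in> ?L" using int integrable_digit_group[OF G] by blast
qed

theorem mainTheorem2:
  shows "decidable_set
           {table_code G | G :: nat monoid. table_group G \<and> integrable_in TYPE(nat) G} \<and>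
         (\<forall>G :: nat monoid. table_group G \<longrightarrow>
            integrable_in TYPE('h) G \<longrightarrow> integrable_in TYPE(nat) G)"
proof (intro conjI allI impI)
  show "decidable_set {table_code G | G :: nat monoid. table_group G \<and> integrable_in TYPE(nat) G}"
    unfolding table_code_set
    by (intro decidable_setI computable_rules) simp_all
  fix G :: "nat monoid"
  assume "table_group G" "integrable_in TYPE('h) G"
  then obtain H :: "'h monoid" where "is_integral H G" "finite (carrier G)"
    by (auto simp: table_group_def integrable_in_def)
  then show "integrable_in TYPE(nat) G"
    using bounded_integral unfolding integrable_in_def by blast
qed

end
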